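(* Let $p$ be an odd prime and let $K$ and $L$ be pure prime degree number fields of degree $p$. Then $K \cong L$ if and only if $\operatorname{sh}(K) = \operatorname{sh}(L)$.
   Context: A pure prime degree number field of degree $p$ is a field $\mathbf{Q}(\alpha)$ where $\alpha$ is a root of $x^p - m$ with $m\in\mathbf{Z}$ $p$-th power free and $m\neq \pm 1$. For a number field $K$ of degree $n$ with complex embeddings $\sigma_1,\dots,\sigma_n$, the Minkowski map is $j:K\to\mathbf{C}^n$, $j(a)=(\sigma_1(a),\dots,\sigma_n(a))$, and $\mathbf{C}^n$ carries the Hermitian inner product $\langle u,v\rangle=\sum_k u_k\overline{v_k}$. For $\beta\in K$ set $\beta^\perp = n\beta - \operatorname{tr}_{K/\mathbf{Q}}(\beta)$, and let $\mathcal{O}_K^\perp=\{\beta^\perp:\beta\in\mathcal{O}_K\}$; then $j(\mathcal{O}_K^\perp)$ is a lattice of rank $n-1$ orthogonal to $j(1)$. The shape $\operatorname{sh}(K)$ is the equivalence class of the lattice $j(\mathcal{O}_K^\perp)$ up to scaling, rotation and reflection; equivalently, the class of its Gram matrix $(\langle j(\beta_i^\perp), j(\beta_k^\perp)\rangle)$ (for any $\mathbf{Z}$-basis) in $\mathrm{GL}_{n-1}(\mathbf{Z})\backslash\mathcal{G}/\mathbf{R}^\times$, where $\mathcal{G}$ is the set of positive definite real symmetric $(n-1)\times(n-1)$ matrices, $g\in\mathrm{GL}_{n-1}(\mathbf{Z})$ acts by $G\mapsto gGg^T$ and $r\in\mathbf{R}^\times$ acts by $G\mapsto r^2G$. *)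

theory Defs
  imports
    "HOL-Algebra.QuotRing"
    "HOL-Algebra.Generated_Fields"
    "HOL-Algebra.Algebraic_Closure_Type"
    "HOL-Library.FuncSet"
    "Jordan_Normal_Form.Matrix"
begin

text \<open>
  A number field is a subset \<open>K\<close> of an arbitrary ambient field type \<open>'a\<close> of characteristic 0,
  the whole type being allowed. Fields in different types can be compared, so no embedding into
  the complex numbers is built in.
\<close>

definition field_of :: "'a::field_char_0 set \<Rightarrow> 'a ring" where
  "field_of K = (ring_of_type_algebra :: 'a ring)\<lparr>carrier := K\<rparr>"

definition power_free :: "nat \<Rightarrow> int \<Rightarrow> bool" where
  "power_free p m \<longleftrightarrow> (\<forall>d. d ^ p dvd m \<longrightarrow> is_unit d)"

definition pure_field :: "nat \<Rightarrow> 'a::field_char_0 set \<Rightarrow> bool" where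
  "pure_field p K \<longleftrightarrow>
     (\<exists>(m::int) \<alpha>. power_free p m \<and> m \<noteq> 1 \<and> m \<noteq> -1 \<and> \<alpha> ^ p = of_int m \<and>
        K = generate_field (ring_of_type_algebra :: 'a ring) {\<alpha>})"

definition field_degree :: "'a::field_char_0 set \<Rightarrow> nat" where
  "field_degree K = vector_space.dim (\<lambda>(q::rat) x. of_rat q * x) K"

text \<open>Extensionality makes an embedding determined by its values on \<open>K\<close>.\<close>

definition embeddings :: "'a::field_char_0 set \<Rightarrow> ('a \<Rightarrow> complex) set" where
  "embeddings K = Ring.ring_hom (field_of K) (field_of UNIV) \<inter> extensional K"

text \<open>
  The numbering of the embeddings is an arbitrary choice; inner products of vectors in the image
  of the Minkowski map do not depend on it.
\<close>

definition embedding_list :: "'a::field_char_0 set \<Rightarrow> ('a \<Rightarrow> complex) list" where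
  "embedding_list K = (SOME \<sigma>s. distinct \<sigma>s \<and> set \<sigma>s = embeddings K)"

definition minkowski :: "'a::field_char_0 set \<Rightarrow> 'a \<Rightarrow> complex vec" where
  "minkowski K a = vec (field_degree K) (\<lambda>k. (embedding_list K ! k) a)"

text \<open>The trace to the rationals, as the sum of the conjugates.\<close>

definition field_trace :: "'a::field_char_0 set \<Rightarrow> 'a \<Rightarrow> rat" where
  "field_trace K \<beta> = (THE q. of_rat q = (\<Sum>\<sigma>\<in>embeddings K. \<sigma> \<beta>))"

definition ring_of_integers :: "'a::field_char_0 set \<Rightarrow> 'a set" where
  "ring_of_integers K = {\<beta> \<in> K. algebraic_int \<beta>}"

definition perp :: "'a::field_char_0 set \<Rightarrow> 'a \<Rightarrow> 'a" where
  "perp K \<beta> = of_nat (field_degree K) * \<beta> - of_rat (field_trace K \<beta>)"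

definition integers_perp :: "'a::field_char_0 set \<Rightarrow> 'a set" where
  "integers_perp K = perp K ` ring_of_integers K"

definition is_Z_basis :: "'a::field_char_0 list \<Rightarrow> 'a set \<Rightarrow> bool" where
  "is_Z_basis bs M \<longleftrightarrow>
     distinct bs \<and>
     \<not> Modules.module.dependent (\<lambda>(k::int) x. of_int k * x) (set bs) \<and>
     Modules.module.span (\<lambda>(k::int) x. of_int k * x) (set bs) = M"

text \<open>
  The inner products below are real, because complex conjugation permutes the embeddings; \<open>Re\<close>
  only changes the type.
\<close>

definition gram_matrix :: "'a::field_char_0 set \<Rightarrow> 'a list \<Rightarrow> real mat" where
  "gram_matrix K bs =
     mat (length bs) (length bs)
       (\<lambda>(i, k). Re (minkowski K (bs ! i) \<bullet>c minkowski K (bs ! k)))"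

definition pos_def_mats :: "nat \<Rightarrow> real mat set" where
  "pos_def_mats d =
     {G \<in> carrier_mat d d. G\<^sup>T = G \<and> (\<forall>v \<in> carrier_vec d. v \<noteq> 0\<^sub>v d \<longrightarrow> v \<bullet> (G *\<^sub>v v) > 0)}"

definition GL_int :: "nat \<Rightarrow> int mat set" where
  "GL_int d = {g \<in> carrier_mat d d. invertible_mat g}"

text \<open>Two matrices are related iff they have the same class in \<open>GL\<^sub>d(Z)\G/R\<^sup>\<times>\<close>.\<close>

definition shape_rel :: "nat \<Rightarrow> (real mat \<times> real mat) set" where
  "shape_rel d =
     {(G, H). G \<in> pos_def_mats d \<and> H \<in> pos_def_mats d \<and>
        (\<exists>g \<in> GL_int d. \<exists>r::real. r \<noteq> 0 \<and>
           H = r\<^sup>2 \<cdot>\<^sub>m (map_mat of_int g * G * (map_mat of_int g)\<^sup>T))}"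

text \<open>
  All Gram matrices of bases of the lattice are equivalent, so this union of their equivalence
  classes is a single class.
\<close>

definition shape :: "'a::field_char_0 set \<Rightarrow> real mat set" where
  "shape K =
     shape_rel (field_degree K - 1) `` {gram_matrix K bs | bs. is_Z_basis bs (integers_perp K)}"

end

theory Submission
  imports Defs "Jordan_Normal_Form.Char_Poly"
begin

text \<open>
  Let \<open>\<alpha> ^ p = m\<close> and \<open>w = \<bar>m\<bar> powr (2 / p)\<close>. For the Minkowski inner product the powers of
  \<open>\<alpha>\<close> are orthogonal and \<open>\<alpha> ^ i\<close> has square length \<open>p * w ^ i\<close>, so that on trace zero elements
  with rational coordinates the form is diagonal with entries \<open>p * w ^ i\<close>, \<open>1 \<le> i < p\<close>.
  These entries are linearly independent over the rationals because \<open>x ^ p - m\<^sup>2\<close> is irreducible.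
  Let \<open>w'\<close> belong to a second field \<open>\<rat>(\<beta>)\<close>. A rational similitude between
  the two forms sends distinct basis vectors to orthogonal vectors, and independence of the
  \<open>w' ^ l\<close> forces these to have disjoint supports; hence the similitude is a monomial matrix and
  \<open>c * w ^ i = t\<^sub>i\<^sup>2 * w' ^ \<pi> i\<close> with rational \<open>t\<^sub>i\<close>. Dividing the cases \<open>i = 1, 2\<close> and taking
  \<open>p\<close>-th powers yields a \<open>p\<close>-th root of \<open>m\<close> in the second field. The ring of integers enters only
  as a full lattice.
\<close>

text \<open>Integral bases of pure fields depend on the factorization of \<open>m\<close> and on
  \<open>m\<close> modulo \<open>p\<^sup>2\<close>, so none is written down. Bounded denominators,
  together with the vectors \<open>p * \<alpha> ^ i\<close> inside the lattice, give a Z-basis and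
  an invertible rational matrix to the power basis. Existence of a basis matters: without one,
  \<open>shape\<close> would be empty and equality of shapes would say nothing. The scale of a
  similitude is an arbitrary real number. It is eliminated by comparing two exponents, which
  requires \<open>p - 1 \<ge> 2\<close>. The form sees only \<open>m\<^sup>2\<close>. Since
  \<open>p\<close> is odd, \<open>- 1\<close> is a \<open>p\<close>-th power, so the sign of
  \<open>m\<close> can be restored; oddness also keeps \<open>m\<^sup>2\<close> from being a
  \<open>p\<close>-th power. The two fields and the complex numbers live in different types.
  Elements are therefore represented by rational polynomials evaluated at a root of
  \<open>m\<close>, and invariance under isomorphism reduces to the fact that all roots of
  \<open>m\<close>, in whatever field, satisfy the same rational relations.\<close>

no_notation fps_nth (infixl "$" 75)

section \<open>Algebraic integers form a ring\<close>

text \<open>The number \<open>x\<close> is an eigenvalue of an integer matrix, hence a root of its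
  characteristic polynomial, which is monic with integer coefficients.\<close>

lemma algebraic_int_if_int_eigenvector:
  fixes x :: "'a::field_char_0" and v :: "nat \<Rightarrow> 'a" and A :: "nat \<Rightarrow> nat \<Rightarrow> int"
  assumes eig: "\<And>i. i < n \<Longrightarrow> x * v i = (\<Sum>j<n. of_int (A i j) * v j)"
    and nz: "i0 < n" "v i0 \<noteq> 0"
  shows "algebraic_int x"
proof -
  define M :: "int mat" where "M = mat n n (\<lambda>(i, j). A i j)"
  define N :: "'a mat" where "N = map_mat of_int M"
  have M: "M \<in> carrier_mat n n" and N: "N \<in> carrier_mat n n"
    by (auto simp: M_def N_def)
  have "N *\<^sub>v vec n v = x \<cdot>\<^sub>v vec n v"
  proof (rule eq_vecI)
    fix i assume "i < dim_vec (x \<cdot>\<^sub>v vec n v)"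
    then have i: "i < n" by simp
    then show "(N *\<^sub>v vec n v) $ i = (x \<cdot>\<^sub>v vec n v) $ i"
      using eig[OF i] by (simp add: N_def M_def scalar_prod_def lessThan_atLeast0)
  qed (simp add: N_def M_def)
  moreover have "vec n v \<noteq> 0\<^sub>v n"
    using nz by (metis index_vec index_zero_vec(1))
  ultimately have "eigenvalue N x"
    using N unfolding eigenvalue_def eigenvector_def by (intro exI[of _ "vec n v"]) auto
  then have "poly (char_poly N) x = 0"
    using eigenvalue_root_char_poly[OF N] by simp
  then have "poly (map_poly of_int (char_poly M)) x = 0"
    unfolding N_def of_int_hom.char_poly_hom[OF M] .
  moreover have "lead_coeff (char_poly M) = 1"
    using degree_monic_char_poly[OF M] by simp
  ultimately show ?thesis
    unfolding algebraic_int_altdef_ipoly by blast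
qed

text \<open>The Z-span of a family. Values of the coefficient function outside \<open>I\<close> are
  irrelevant, and the family may have repetitions.\<close>

definition int_lin :: "'i set \<Rightarrow> ('i \<Rightarrow> 'a::comm_ring_1) \<Rightarrow> 'a set" where
  "int_lin I v = range (\<lambda>k::'i \<Rightarrow> int. \<Sum>i\<in>I. of_int (k i) * v i)"

lemma int_lin_add:
  fixes v :: "'i \<Rightarrow> 'a::comm_ring_1"
  assumes "x \<in> int_lin I v" "y \<in> int_lin I v"
  shows "x + y \<in> int_lin I v"
proof -
  from assms obtain k l :: "'i \<Rightarrow> int"
    where "x = (\<Sum>i\<in>I. of_int (k i) * v i)" "y = (\<Sum>i\<in>I. of_int (l i) * v i)"
    by (auto simp: int_lin_def)
  then have "x + y = (\<Sum>i\<in>I. of_int (k i + l i) * v i)"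
    by (simp add: sum.distrib algebra_simps)
  then show ?thesis unfolding int_lin_def by (rule range_eqI[of _ _ "\<lambda>i. k i + l i"])
qed

lemma int_lin_scale:
  fixes v :: "'i \<Rightarrow> 'a::comm_ring_1"
  assumes "x \<in> int_lin I v"
  shows "of_int c * x \<in> int_lin I v"
proof -
  from assms obtain k :: "'i \<Rightarrow> int" where "x = (\<Sum>i\<in>I. of_int (k i) * v i)"
    by (auto simp: int_lin_def)
  then have "of_int c * x = (\<Sum>i\<in>I. of_int (c * k i) * v i)"
    by (simp add: sum_distrib_left algebra_simps)
  then show ?thesis unfolding int_lin_def by (rule range_eqI[of _ _ "\<lambda>i. c * k i"])
qed

lemma int_lin_zero: "0 \<in> int_lin I v"
  unfolding int_lin_def by (rule range_eqI[of _ _ "\<lambda>_. 0"]) simp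

lemma int_lin_sum:
  assumes "\<And>j. j \<in> J \<Longrightarrow> w j \<in> int_lin I v"
  shows "(\<Sum>j\<in>J. of_int (c j) * w j) \<in> int_lin I v"
  using assms
  by (induction J rule: infinite_finite_induct)
     (simp_all add: int_lin_add int_lin_scale int_lin_zero)

lemma int_lin_gen:
  assumes "finite I" "i \<in> I"
  shows "v i \<in> int_lin I v"
  unfolding int_lin_def using assms
  by (intro range_eqI[of _ _ "\<lambda>j. if j = i then 1 else 0"])
     (simp add: if_distrib[of of_int] if_distrib[of "\<lambda>z. z * _"] cong: if_cong)

lemma int_lin_mult:
  fixes v :: "'i \<Rightarrow> 'a::comm_ring_1"
  assumes "\<And>i. i \<in> I \<Longrightarrow> x * v i \<in> int_lin I v" "y \<in> int_lin I v"
  shows "x * y \<in> int_lin I v"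
proof -
  obtain k :: "'i \<Rightarrow> int" where "y = (\<Sum>i\<in>I. of_int (k i) * v i)"
    using assms(2) by (auto simp: int_lin_def)
  then have "x * y = (\<Sum>i\<in>I. of_int (k i) * (x * v i))"
    by (simp add: sum_distrib_left algebra_simps)
  then show ?thesis using assms(1) by (simp add: int_lin_sum)
qed

text \<open>A finitely generated Z-module that contains a nonzero generator and is stable under
  \<open>x\<close> makes \<open>x\<close> integral. The index type is arbitrary so that pairs of
  exponents can serve as indices.\<close>

lemma algebraic_int_if_stable:
  fixes x :: "'a::field_char_0" and v :: "'i \<Rightarrow> 'a"
  assumes I: "finite I" and st: "\<And>i. i \<in> I \<Longrightarrow> x * v i \<in> int_lin I v"
    and nz: "i0 \<in> I" "v i0 \<noteq> 0"
  shows "algebraic_int x"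
proof -
  obtain h where h: "bij_betw h {..<card I} I"
    using ex_bij_betw_nat_finite[OF I] by (auto simp: lessThan_atLeast0)
  have "\<forall>i\<in>I. \<exists>k::'i \<Rightarrow> int. x * v i = (\<Sum>j\<in>I. of_int (k j) * v j)"
    using st by (auto simp: int_lin_def image_iff)
  then obtain k :: "'i \<Rightarrow> 'i \<Rightarrow> int" where k: "\<And>i. i \<in> I \<Longrightarrow> x * v i = (\<Sum>j\<in>I. of_int (k i j) * v j)"
    by metis
  obtain j0 where j0: "j0 < card I" "h j0 = i0"
    using h nz(1) unfolding bij_betw_def by (metis imageE lessThan_iff)
  show ?thesis
  proof (rule algebraic_int_if_int_eigenvector[of "card I" x "\<lambda>i. v (h i)" "\<lambda>i j. k (h i) (h j)"])
    fix i assume "i < card I"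
    then have "h i \<in> I" using h by (auto simp: bij_betw_def)
    from k[OF this] show "x * v (h i) = (\<Sum>j<card I. of_int (k (h i) (h j)) * v (h j))"
      by (simp add: sum.reindex_bij_betw[OF h, of "\<lambda>j. of_int (k (h i) j) * v j"])
  qed (use j0 nz in auto)
qed

lemma algebraic_int_obtain_recurrence:
  fixes x :: "'a::field_char_0"
  assumes "algebraic_int x"
  obtains d :: nat and c :: "nat \<Rightarrow> int" where "d > 0" "x ^ d = (\<Sum>i<d. of_int (c i) * x ^ i)"
proof -
  obtain f :: "int poly" where f: "poly (map_poly of_int f) x = 0" "lead_coeff f = 1"
    using assms unfolding algebraic_int_altdef_ipoly by blast
  define d where "d = degree f"
  have "(\<Sum>i\<le>d. of_int (coeff f i) * x ^ i) = 0"
    using f(1) by (simp add: poly_altdef d_def degree_map_poly coeff_map_poly)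
  moreover have "(\<Sum>i\<le>d. of_int (coeff f i) * x ^ i) = (\<Sum>i<d. of_int (coeff f i) * x ^ i) + x ^ d"
    using f(2) by (simp add: d_def lessThan_Suc_atMost[symmetric])
  ultimately have e: "x ^ d = (\<Sum>i<d. of_int (- coeff f i) * x ^ i)"
    by (simp add: sum_negf add_eq_0_iff)
  have "d > 0"
  proof (rule ccontr)
    assume "\<not> d > 0"
    then have "d = 0" by simp
    with e show False by simp
  qed
  then show ?thesis using e by (rule that)
qed

text \<open>The Z-module spanned by the products \<open>x ^ i * y ^ j\<close> below the degrees of
  the two recurrences is stable under \<open>x\<close> and \<open>y\<close>, hence under their sum
  and product.\<close>

lemma
  fixes x y :: "'a::field_char_0"
  assumes "algebraic_int x" "algebraic_int y"
  shows algebraic_int_plus: "algebraic_int (x + y)"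
    and algebraic_int_times: "algebraic_int (x * y)"
proof -
  obtain d :: nat and c :: "nat \<Rightarrow> int" where d: "d > 0" "x ^ d = (\<Sum>i<d. of_int (c i) * x ^ i)"
    using algebraic_int_obtain_recurrence[OF assms(1)] by blast
  obtain e :: nat and b :: "nat \<Rightarrow> int" where e: "e > 0" "y ^ e = (\<Sum>i<e. of_int (b i) * y ^ i)"
    using algebraic_int_obtain_recurrence[OF assms(2)] by blast
  define I where "I = {..<d} \<times> {..<e}"
  define v where "v = (\<lambda>(i, j). x ^ i * y ^ j)"
  have I: "finite I" "(0, 0) \<in> I" "v (0, 0) \<noteq> 0"
    using d(1) e(1) by (auto simp: I_def v_def)
  have g: "x ^ i * y ^ j \<in> int_lin I v" if "i < d" "j < e" for i j
    using int_lin_gen[OF I(1), of "(i, j)" v] that by (simp add: I_def v_def)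
  have x: "x * v t \<in> int_lin I v" if tI: "t \<in> I" for t
  proof -
    obtain i j where t: "t = (i, j)" "i < d" "j < e" using tI unfolding I_def by blast
    show ?thesis
    proof (cases "Suc i = d")
      case True
      have "x * v t = x ^ d * y ^ j" by (simp add: t v_def flip: True)
      also have "\<dots> = (\<Sum>k<d. of_int (c k) * (x ^ k * y ^ j))"
        unfolding d(2) sum_distrib_right by (simp add: mult.assoc)
      finally show ?thesis using g t(2,3) by (auto intro: int_lin_sum)
    next
      case False
      then show ?thesis using g[of "Suc i" j] t by (simp add: v_def mult.assoc)
    qed
  qed
  have y: "y * v t \<in> int_lin I v" if tI: "t \<in> I" for t
  proof -
    obtain i j where t: "t = (i, j)" "i < d" "j < e" using tI unfolding I_def by blast
    show ?thesis
    proof (cases "Suc j = e")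
      case True
      have "y * v t = x ^ i * y ^ e" by (simp add: t v_def flip: True)
      also have "\<dots> = (\<Sum>k<e. of_int (b k) * (x ^ i * y ^ k))"
        unfolding e(2) sum_distrib_left by (simp add: ac_simps)
      finally show ?thesis using g t(2,3) by (auto intro: int_lin_sum)
    next
      case False
      then show ?thesis using g[of i "Suc j"] t by (simp add: v_def ac_simps)
    qed
  qed
  have add: "(x + y) * v t \<in> int_lin I v" if "t \<in> I" for t
    unfolding distrib_right by (intro int_lin_add x y that)
  show "algebraic_int (x + y)"
    by (rule algebraic_int_if_stable[where I = I and v = v and ?i0.0 = "(0, 0)", OF I(1) add I(2,3)])
  have mult: "x * y * v t \<in> int_lin I v" if "t \<in> I" for t
    unfolding mult.assoc by (rule int_lin_mult[OF x y[OF that]])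
  show "algebraic_int (x * y)"
    by (rule algebraic_int_if_stable[where I = I and v = v and ?i0.0 = "(0, 0)", OF I(1) mult I(2,3)])
qed

lemma algebraic_int_sum: "(\<And>i. i \<in> I \<Longrightarrow> algebraic_int (f i)) \<Longrightarrow> algebraic_int (\<Sum>i\<in>I. f i)"
  for f :: "'i \<Rightarrow> 'a::field_char_0"
  by (induction I rule: infinite_finite_induct) (simp_all add: algebraic_int_plus)

lemma algebraic_int_power: "algebraic_int x \<Longrightarrow> algebraic_int (x ^ k)"
  for x :: "'a::field_char_0"
  by (induction k) (simp_all add: algebraic_int_times int_imp_algebraic_int)

section \<open>Irreducibility of pure polynomials\<close>

text \<open>The target type is free: one rational polynomial is evaluated in both fields, in the
  complex numbers and at the real number \<open>w\<close>.\<close>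

definition ev :: "rat poly \<Rightarrow> 'a::field_char_0 \<Rightarrow> 'a" where
  "ev f x = poly (map_poly of_rat f) x"

lemma ev_0 [simp]: "ev 0 x = 0"
  by (simp add: ev_def)

lemma ev_pCons [simp]: "ev (pCons a f) x = of_rat a + x * ev f x"
  by (simp add: ev_def of_rat_hom.map_poly_pCons_hom)

lemma ev_1 [simp]: "ev 1 x = 1"
  by (simp add: one_pCons del: pCons_one)

lemma ev_add [simp]: "ev (f + g) x = ev f x + ev g x"
  by (simp add: ev_def of_rat_hom.map_poly_hom_add)

lemma ev_smult [simp]: "ev (smult c f) x = of_rat c * ev f x"
  by (induction f) (simp_all add: of_rat_mult algebra_simps)

lemma ev_mult [simp]: "ev (f * g) x = ev f x * ev g x"
  by (induction f) (simp_all add: algebra_simps)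

lemma ev_minus [simp]: "ev (- f) x = - ev f x"
  using ev_smult[of "-1" f x] by (simp add: of_rat_minus)

lemma ev_diff [simp]: "ev (f - g) x = ev f x - ev g x"
  using ev_add[of f "- g" x] by simp

lemma ev_monom [simp]: "ev (monom c n) x = of_rat c * x ^ n"
  by (simp add: ev_def map_poly_monom poly_monom)

lemma ev_eq_sum: "degree f < n \<Longrightarrow> ev f x = (\<Sum>i<n. of_rat (coeff f i) * x ^ i)"
proof -
  assume "degree f < n"
  then have "f = (\<Sum>i<n. monom (coeff f i) i)"
    by (intro poly_eqI) (simp add: coeff_sum coeff_eq_0)
  then have "ev f x = ev (\<Sum>i<n. monom (coeff f i) i) x" by simp
  also have "\<dots> = (\<Sum>i<n. ev (monom (coeff f i) i) x)"
    by (induction n) simp_all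
  finally show ?thesis by simp
qed

lemma cmod_of_rat: "cmod (of_rat r) = real_of_rat \<bar>r\<bar>"
  by (cases r) (simp add: of_rat_rat norm_divide)

text \<open>Bezout gives \<open>d * a = p * b + 1\<close>, so
  \<open>(y ^ a) ^ p = x ^ (p * b) * x\<close> and \<open>y ^ a / x ^ b\<close> is the desired
  root.\<close>

lemma coprime_power_eq_imp_power:
  fixes x y :: "'a::field"
  assumes "y ^ p = x ^ d" "coprime d p" "x \<noteq> 0" "d > 0"
  obtains q where "q ^ p = x"
proof -
  obtain a b where ab: "d * a = p * b + gcd d p"
    using bezout_nat[of d p] \<open>d > 0\<close> by auto
  have "(y ^ a) ^ p = (y ^ p) ^ a"
    by (simp add: mult.commute flip: power_mult)
  also have "\<dots> = x ^ (p * b + 1)"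
    using ab assms(1,2) by (simp add: flip: power_mult)
  also have "\<dots> = (x ^ b) ^ p * x"
    by (simp add: mult.commute flip: power_mult)
  finally have "(y ^ a / x ^ b) ^ p = x"
    using \<open>x \<noteq> 0\<close> by (simp add: power_divide)
  then show ?thesis by (rule that)
qed

definition pure_poly :: "nat \<Rightarrow> int \<Rightarrow> rat poly" where
  "pure_poly p m = monom 1 p - [:of_int m:]"

lemma ev_pure_poly [simp]: "ev (pure_poly p m) x = x ^ p - of_int m"
  by (simp add: pure_poly_def)

text \<open>Not being a rational \<open>p\<close>-th power is what irreducibility needs. Unlike
  being \<open>p\<close>-th power free, this property passes from \<open>m\<close> to
  \<open>m\<^sup>2\<close>.\<close>

locale pure_radicand =
  fixes p :: nat and m :: int
  assumes prime_p: "prime p" and odd_p: "odd p"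
    and not_power: "\<And>q::rat. q ^ p \<noteq> of_int m"
begin

lemma p_gt_2: "p > 2"
  using prime_p odd_p prime_ge_2_nat[of p] by (cases "p = 2") auto

lemma p_gt_0 [simp]: "p > 0"
  using p_gt_2 by simp

lemma m_nonzero [simp]: "m \<noteq> 0"
  using not_power[of 0] p_gt_0 by (auto simp: power_0_left)

lemma degree_pure_poly [simp]: "degree (pure_poly p m) = p"
  and lead_coeff_pure_poly: "lead_coeff (pure_poly p m) = 1"
proof -
  have "coeff (pure_poly p m) p = 1"
    using p_gt_0 by (cases p) (auto simp: pure_poly_def)
  moreover have "coeff (pure_poly p m) i = 0" if "i > p" for i
    using that by (cases i) (auto simp: pure_poly_def)
  ultimately show "degree (pure_poly p m) = p"
    by (intro antisym degree_le le_degree) auto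
  with \<open>coeff (pure_poly p m) p = 1\<close> show "lead_coeff (pure_poly p m) = 1" by simp
qed

lemma pure_poly_nonzero [simp]: "pure_poly p m \<noteq> 0"
  using lead_coeff_pure_poly by auto

text \<open>All complex roots of \<open>x ^ p - m\<close> have the same absolute value, so the
  absolute value of the product of the roots of a factor depends only on its degree
  \<open>d\<close>. As \<open>d\<close> is coprime to \<open>p\<close>, already
  \<open>\<bar>m\<bar>\<close> would be a \<open>p\<close>-th power, and for odd \<open>p\<close> so
  would \<open>m\<close>.\<close>

lemma pure_poly_no_factor:
  assumes "g dvd pure_poly p m" "degree g < p"
  shows "degree g = 0"
proof (rule ccontr)
  assume d: "degree g \<noteq> 0"
  define d where "d = degree g"
  define G :: "complex poly" where "G = map_poly of_rat g"
  have "lead_coeff G = of_rat (lead_coeff g)" "degree G = d"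
    by (simp_all add: G_def d_def)
  moreover obtain as where as: "smult (lead_coeff G) (\<Prod>a\<leftarrow>as. [:- a, 1:]) = G" "length as = degree G"
    using fundamental_theorem_algebra_factorized[of G] by auto
  ultimately have G: "G = smult (of_rat (lead_coeff g)) (\<Prod>a\<leftarrow>as. [:- a, 1:])"
    and len: "length as = d" by simp_all
  have root: "cmod a ^ p = \<bar>of_int m\<bar>" if "a \<in> set as" for a
  proof -
    have "poly G a = 0"
      using that unfolding G by (auto simp: poly_prod_list prod_list_zero_iff)
    then have "ev g a = 0" by (simp add: ev_def G_def)
    moreover obtain h where "pure_poly p m = g * h" using assms(1) by (elim dvdE)
    ultimately have "ev (pure_poly p m) a = 0" by simp
    then have "cmod (a ^ p) = cmod (of_int m)" by simp
    then show ?thesis by (simp add: norm_power)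
  qed
  \<comment> \<open>The constant coefficient of \<open>g\<close> makes \<open>\<bar>m\<bar> ^ d\<close> a \<open>p\<close>-th power of a rational.\<close>
  have "(\<Prod>a\<leftarrow>as. cmod a) ^ p = \<bar>of_int m\<bar> ^ length as"
    using root by (induction as) (simp_all add: power_mult_distrib)
  moreover have "cmod (poly (\<Prod>a\<leftarrow>as. [:- a, 1:]) 0) = (\<Prod>a\<leftarrow>as. cmod a)"
    by (induction as) (simp_all add: norm_mult)
  moreover have "poly (\<Prod>a\<leftarrow>as. [:- a, 1:]) 0 = of_rat (coeff g 0 / lead_coeff g)"
  proof -
    have "poly G 0 = of_rat (coeff g 0)"
      by (simp add: G_def poly_0_coeff_0)
    moreover have "g \<noteq> 0" using d by auto
    ultimately show ?thesis
      by (subst (asm) G) (auto simp: of_rat_divide field_simps)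
  qed
  ultimately have "(cmod (of_rat (coeff g 0 / lead_coeff g))) ^ p = \<bar>of_int m\<bar> ^ d"
    using len by simp
  then have "real_of_rat (\<bar>coeff g 0 / lead_coeff g\<bar> ^ p) = real_of_rat (\<bar>of_int m\<bar> ^ d)"
    by (simp add: of_rat_power cmod_of_rat flip: of_int_abs)
  then have "\<bar>coeff g 0 / lead_coeff g\<bar> ^ p = \<bar>of_int m\<bar> ^ d"
    by (simp only: of_rat_eq_iff)
  moreover have "coprime d p"
    using prime_p assms(2) d unfolding d_def
    by (metis coprime_commute dvd_imp_le linorder_not_less not_gr_zero prime_imp_coprime)
  ultimately obtain q :: rat where q: "q ^ p = \<bar>of_int m\<bar>"
    using d by (auto elim!: coprime_power_eq_imp_power simp: d_def)
  then have "q ^ p = of_int m \<or> (- q) ^ p = of_int m"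
    using odd_p by (auto simp: abs_if split: if_splits)
  then show False using not_power by blast
qed

text \<open>Irreducibility in the form that yields both linear independence of powers and inverses
  of field elements.\<close>

lemma pure_poly_bezout:
  assumes "f \<noteq> 0" "degree f < p"
  obtains u v where "u * pure_poly p m + v * f = 1"
proof -
  define g where "g = gcd (pure_poly p m) f"
  have "degree g \<le> degree f"
    unfolding g_def using assms(1) by (intro dvd_imp_degree_le) auto
  then have "degree g = 0"
    using assms(2) by (intro pure_poly_no_factor) (auto simp: g_def)
  moreover have "g \<noteq> 0" using assms(1) by (simp add: g_def)
  ultimately have "is_unit g" by (simp add: is_unit_iff_degree)
  then have "g = 1" unfolding g_def by (metis is_unit_gcd coprime_iff_gcd_eq_1)
  then show ?thesis
    using that bezout_coefficients_fst_snd[of "pure_poly p m" f] by (simp add: g_def)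
qed

lemma ev_mod:
  assumes "x ^ p = of_int m"
  shows "ev (f mod pure_poly p m) x = ev f x"
proof -
  have "ev f x = ev (f div pure_poly p m * pure_poly p m + f mod pure_poly p m) x"
    by (simp only: div_mult_mod_eq)
  also have "\<dots> = ev (f mod pure_poly p m) x"
    unfolding ev_add ev_mult by (simp add: assms)
  finally show ?thesis by simp
qed

lemma degree_mod: "degree (f mod pure_poly p m) < p"
  using degree_mod_less'[of "pure_poly p m" f] by (cases "f mod pure_poly p m = 0") auto

lemma ev_eq_0_imp:
  assumes "x ^ p = of_int m" "degree f < p" "ev f x = 0"
  shows "f = 0"
proof (rule ccontr)
  assume "f \<noteq> 0"
  then obtain u v where "u * pure_poly p m + v * f = 1"
    using pure_poly_bezout assms(2) by blast
  then have "ev (u * pure_poly p m + v * f) x = 1" by simp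
  then show False using assms by simp
qed

lemma ev_inj:
  assumes "x ^ p = of_int m" "degree f < p" "degree g < p" "ev f x = ev g x"
  shows "f = g"
  using ev_eq_0_imp[of x "f - g"] assms degree_diff_less[of f p g] by simp

text \<open>The root \<open>x\<close> may lie in any field of characteristic 0. Besides
  \<open>\<alpha>\<close>, this covers the real number \<open>w\<close> as a root of the radicand
  \<open>m\<^sup>2\<close>.\<close>

lemma power_independent:
  assumes "x ^ p = of_int m" "(\<Sum>i<p. of_rat (c i) * x ^ i) = 0" "i < p"
  shows "c i = 0"
proof -
  define f where "f = (\<Sum>i<p. monom (c i) i)"
  have f: "coeff f j = (if j < p then c j else 0)" for j
    by (simp add: f_def coeff_sum)
  then have deg: "degree f < p"
    using p_gt_0 by (intro degree_lessI) auto
  then have "ev f x = 0"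
    using assms(2) by (simp add: ev_eq_sum[of f p] f)
  with deg have "f = 0" using ev_eq_0_imp assms(1) by blast
  then show ?thesis using f[of i] assms(3) by simp
qed

lemma ev_inverse:
  assumes "x ^ p = of_int m" "ev f x \<noteq> 0"
  obtains g where "ev g x = inverse (ev f x)"
proof -
  define f' where "f' = f mod pure_poly p m"
  have f': "ev f' x = ev f x" "degree f' < p"
    using assms(1) by (simp_all add: f'_def ev_mod degree_mod)
  then have "f' \<noteq> 0" using assms(2) by auto
  with f'(2) obtain u v where "u * pure_poly p m + v * f' = 1"
    using pure_poly_bezout[of f'] by blast
  then have "ev (u * pure_poly p m + v * f') x = 1" by simp
  then have "ev v x * ev f x = 1" using assms(1) f' by simp
  then show ?thesis using that by (metis inverse_unique mult.commute)
qed

end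

section \<open>Generated fields and their embeddings\<close>

lemma field_of_simps [simp]:
  "carrier (field_of K) = K"
  "x \<otimes>\<^bsub>field_of K\<^esub> y = x * y"
  "x \<oplus>\<^bsub>field_of K\<^esub> y = x + y"
  "\<one>\<^bsub>field_of K\<^esub> = 1"
  by (simp_all add: field_of_def ring_of_type_algebra_def)

lemma type_algebra_simps [simp]:
  "carrier ring_of_type_algebra = UNIV"
  "x \<otimes>\<^bsub>ring_of_type_algebra\<^esub> y = x * y"
  "x \<oplus>\<^bsub>ring_of_type_algebra\<^esub> y = x + y"
  "\<one>\<^bsub>ring_of_type_algebra\<^esub> = 1"
  "\<zero>\<^bsub>ring_of_type_algebra\<^esub> = 0"
  by (simp_all add: ring_of_type_algebra_def)

lemma type_algebra_a_inv [simp]: "\<ominus>\<^bsub>ring_of_type_algebra\<^esub> x = - (x :: 'a::Fields.field)"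
proof -
  interpret cring "ring_of_type_algebra :: 'a ring" by (rule cring_from_type_algebra)
  show ?thesis using minus_equality[of "- x" x] by simp
qed

lemma type_algebra_m_inv [simp]:
  "x \<noteq> 0 \<Longrightarrow> inv\<^bsub>ring_of_type_algebra\<^esub> x = inverse (x :: 'a::Fields.field)"
proof -
  interpret cring "ring_of_type_algebra :: 'a ring" by (rule cring_from_type_algebra)
  assume "x \<noteq> 0"
  then show ?thesis using comm_inv_char[of x "inverse x"] by simp
qed

lemma ring_hom_field_of_iff:
  "h \<in> Ring.ring_hom (field_of K) (field_of L) \<longleftrightarrow>
     (\<forall>x\<in>K. h x \<in> L) \<and> (\<forall>x\<in>K. \<forall>y\<in>K. h (x * y) = h x * h y \<and> h (x + y) = h x + h y) \<and> h 1 = 1"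
  unfolding Ring.ring_hom_def by auto

text \<open>The ring generated by \<alpha> over the rationals. It is a field as soon as \<alpha> is
  a root of a pure radicand.\<close>

definition pure_gen :: "'a::field_char_0 \<Rightarrow> 'a set" where
  "pure_gen \<alpha> = range (\<lambda>f. ev f \<alpha>)"

lemma
  shows pure_gen_0: "0 \<in> pure_gen \<alpha>"
    and pure_gen_1: "1 \<in> pure_gen \<alpha>"
    and pure_gen_of_rat: "of_rat q \<in> pure_gen \<alpha>"
    and pure_gen_self: "\<alpha> \<in> pure_gen \<alpha>"
    and pure_gen_add: "x \<in> pure_gen \<alpha> \<Longrightarrow> y \<in> pure_gen \<alpha> \<Longrightarrow> x + y \<in> pure_gen \<alpha>"
    and pure_gen_mult: "x \<in> pure_gen \<alpha> \<Longrightarrow> y \<in> pure_gen \<alpha> \<Longrightarrow> x * y \<in> pure_gen \<alpha>"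
    and pure_gen_uminus: "x \<in> pure_gen \<alpha> \<Longrightarrow> - x \<in> pure_gen \<alpha>"
proof -
  have I: "ev f \<alpha> \<in> pure_gen \<alpha>" for f by (simp add: pure_gen_def)
  show "0 \<in> pure_gen \<alpha>" using I[of 0] by simp
  show "1 \<in> pure_gen \<alpha>" using I[of 1] by simp
  show "of_rat q \<in> pure_gen \<alpha>" using I[of "[:q:]"] by simp
  show "\<alpha> \<in> pure_gen \<alpha>" using I[of "[:0, 1:]"] by simp
  show "x + y \<in> pure_gen \<alpha>" if "x \<in> pure_gen \<alpha>" "y \<in> pure_gen \<alpha>"
    using that I ev_add unfolding pure_gen_def image_iff by metis
  show "x * y \<in> pure_gen \<alpha>" if "x \<in> pure_gen \<alpha>" "y \<in> pure_gen \<alpha>"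
    using that I ev_mult unfolding pure_gen_def image_iff by metis
  show "- x \<in> pure_gen \<alpha>" if "x \<in> pure_gen \<alpha>"
    using that I ev_minus unfolding pure_gen_def image_iff by metis
qed

lemma pure_gen_power: "x \<in> pure_gen \<alpha> \<Longrightarrow> x ^ n \<in> pure_gen \<alpha>"
  by (induction n) (auto intro: pure_gen_1 pure_gen_mult)

lemma pure_gen_subset:
  assumes "\<alpha> \<in> K" "\<And>q. of_rat q \<in> K" "\<And>x y. x \<in> K \<Longrightarrow> y \<in> K \<Longrightarrow> x + y \<in> K"
    "\<And>x y. x \<in> K \<Longrightarrow> y \<in> K \<Longrightarrow> x * y \<in> K"
  shows "pure_gen \<alpha> \<subseteq> K"
proof -
  have "ev f \<alpha> \<in> K" for f
    using assms(2)[of 0] by (induction f) (simp_all add: assms)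
  then show ?thesis by (auto simp: pure_gen_def)
qed

lemma (in pure_radicand) pure_gen_inverse:
  assumes "\<alpha> ^ p = of_int m" "x \<in> pure_gen \<alpha>"
  shows "inverse x \<in> pure_gen \<alpha>"
proof (cases "x = 0")
  case False
  obtain f where "x = ev f \<alpha>" using assms(2) by (auto simp: pure_gen_def)
  with False assms(1) show ?thesis
    by (metis ev_inverse pure_gen_def rangeI)
qed (simp add: pure_gen_0)

lemma (in pure_radicand) generate_field_eq:
  assumes "\<alpha> ^ p = of_int m"
  shows "generate_field (ring_of_type_algebra :: 'a::field_char_0 ring) {\<alpha>} = pure_gen \<alpha>"
    (is "?G = _")
proof (intro antisym subsetI)
  fix x assume "x \<in> ?G"
  then show "x \<in> pure_gen \<alpha>"
    by induction
       (auto intro: pure_gen_1 pure_gen_self pure_gen_uminus pure_gen_add pure_gen_mult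
          pure_gen_inverse[OF assms])
next
  have add: "x + y \<in> ?G" if "x \<in> ?G" "y \<in> ?G" for x y
    using generate_field.eng_add[OF that] by simp
  have mult: "x * y \<in> ?G" if "x \<in> ?G" "y \<in> ?G" for x y
    using generate_field.eng_mult[OF that] by simp
  have minus: "- x \<in> ?G" if "x \<in> ?G" for x
    using generate_field.a_inv[OF that] by simp
  have one: "1 \<in> ?G"
    using generate_field.one[of ring_of_type_algebra "{\<alpha>}"] by simp
  \<comment> \<open>The base case 0 is obtained as \<open>1 + (- 1)\<close>.\<close>
  have nat: "of_nat n \<in> ?G" for n
    using add[OF one minus[OF one]] by (induction n) (simp_all add: add one)
  have int: "of_int n \<in> ?G" for n
    by (cases n) (simp_all add: nat minus del: of_nat_Suc)
  have rat: "of_rat q \<in> ?G" for q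
  proof -
    obtain a b where q: "quotient_of q = (a, b)" by force
    then have b: "b > 0" "q = of_int a / of_int b"
      by (simp_all add: quotient_of_denom_pos quotient_of_div)
    then have "inverse (of_int b) \<in> ?G"
      using generate_field.m_inv[OF int[of b]] by simp
    moreover have "(of_rat q :: 'a) = of_int a * inverse (of_int b)"
      by (simp add: b(2) of_rat_mult of_rat_inverse divide_inverse)
    ultimately show ?thesis using mult[OF int[of a]] by simp
  qed
  have "\<alpha> \<in> ?G" by (simp add: generate_field.incl)
  then have "pure_gen \<alpha> \<subseteq> ?G" by (intro pure_gen_subset add mult rat)
  then show "x \<in> ?G" if "x \<in> pure_gen \<alpha>" for x using that by blast
qed

text \<open>A homomorphism that respects sums, products and 1 fixes the rationals, so it is
  determined by the image of the generator.\<close>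

lemma ring_hom_ev:
  fixes h :: "'a::field_char_0 \<Rightarrow> 'b::field_char_0"
  assumes "h \<in> Ring.ring_hom (field_of (pure_gen \<alpha>)) (field_of L)"
  shows "h (ev f \<alpha>) = ev f (h \<alpha>)"
proof -
  let ?K = "pure_gen \<alpha>"
  have add: "h (x + y) = h x + h y" if "x \<in> ?K" "y \<in> ?K" for x y
    using assms that by (simp add: ring_hom_field_of_iff)
  have mult: "h (x * y) = h x * h y" if "x \<in> ?K" "y \<in> ?K" for x y
    using assms that by (simp add: ring_hom_field_of_iff)
  have one: "h 1 = 1" using assms by (simp add: ring_hom_field_of_iff)
  have int_in: "of_int n \<in> ?K" for n
    using pure_gen_of_rat[of "of_int n" \<alpha>] by simp
  have nat_in: "of_nat n \<in> ?K" for n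
    using int_in[of "int n"] by simp
  have zero: "h 0 = 0"
    using add[OF pure_gen_0 pure_gen_0] by simp
  have minus: "h (- x) = - h x" if "x \<in> ?K" for x
    using add[OF that pure_gen_uminus[OF that]] zero by (simp add: eq_neg_iff_add_eq_0 add.commute)
  have nat: "h (of_nat n) = of_nat n" for n
    by (induction n) (simp_all add: zero one add[OF pure_gen_1 nat_in])
  have int: "h (of_int n) = of_int n" for n
    using minus[OF nat_in] by (cases n) (simp_all add: nat del: of_nat_Suc)
  have rat: "h (of_rat q) = of_rat q" for q
  proof -
    obtain a b where q: "quotient_of q = (a, b)" by force
    then have b: "b > 0" "q = of_int a / of_int b"
      by (simp_all add: quotient_of_denom_pos quotient_of_div)
    have "h (of_int b * of_rat q) = of_int b * h (of_rat q)"
      by (simp add: mult[OF int_in pure_gen_of_rat] int)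
    moreover have "(of_int b :: 'a) * of_rat q = of_int a"
      using b by (simp add: of_rat_divide)
    ultimately have "of_int a = of_int b * h (of_rat q)" by (simp add: int)
    then have "h (of_rat q) = of_int a / of_int b" using b(1) by (simp add: field_simps)
    also have "\<dots> = of_rat q" by (simp add: b(2) of_rat_divide)
    finally show ?thesis .
  qed
  show "h (ev f \<alpha>) = ev f (h \<alpha>)"
  proof (induction f)
    case (pCons a f)
    have e: "ev f \<alpha> \<in> ?K" by (simp add: pure_gen_def)
    then show ?case
      using pCons by (simp add: add pure_gen_of_rat pure_gen_mult pure_gen_self mult rat)
  qed (simp add: zero)
qed

section \<open>Passage between roots of the same radicand\<close>

context pure_radicand
begin

text \<open>Every element has a unique representative of degree below \<open>p\<close> modulo
  \<open>pure_poly p m\<close>, and reducing to it does not depend on the root. So all roots of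
  \<open>m\<close> satisfy the same rational relations.\<close>

lemma ev_transfer:
  fixes \<alpha> :: "'a::field_char_0" and \<gamma> :: "'b::field_char_0"
  assumes "\<alpha> ^ p = of_int m" "\<gamma> ^ p = of_int m" "ev f \<alpha> = ev g \<alpha>"
  shows "ev f \<gamma> = ev g \<gamma>"
proof -
  have "f mod pure_poly p m = g mod pure_poly p m"
    using assms by (intro ev_inj[OF assms(1)] degree_mod) (simp add: ev_mod)
  then show ?thesis using ev_mod[OF assms(2)] by metis
qed

text \<open>The isomorphism that sends \<alpha> to \<gamma>. By \<open>ev_transfer\<close> the
  choice of the polynomial does not affect the value when both are roots of
  \<open>m\<close>.\<close>

definition transfer :: "'a::field_char_0 \<Rightarrow> 'b::field_char_0 \<Rightarrow> 'a \<Rightarrow> 'b" where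
  "transfer \<alpha> \<gamma> x = ev (SOME f. x = ev f \<alpha>) \<gamma>"

lemma transfer_ev:
  assumes "\<alpha> ^ p = of_int m" "\<gamma> ^ p = of_int m"
  shows "transfer \<alpha> \<gamma> (ev f \<alpha>) = ev f \<gamma>"
  unfolding transfer_def
  by (rule someI2[of "\<lambda>g. ev f \<alpha> = ev g \<alpha>" f]) (auto intro: ev_transfer[OF assms])

lemma transfer_hom:
  assumes "\<alpha> ^ p = of_int m" "\<gamma> ^ p = of_int m" "\<And>f. ev f \<gamma> \<in> L"
  shows "transfer \<alpha> \<gamma> \<in> Ring.ring_hom (field_of (pure_gen \<alpha>)) (field_of L)"
proof -
  note [simp] = transfer_ev[OF assms(1,2)]
  have "transfer \<alpha> \<gamma> (ev f \<alpha> * ev g \<alpha>) = ev f \<gamma> * ev g \<gamma>" for f g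
    using transfer_ev[OF assms(1,2), of "f * g"] by simp
  moreover have "transfer \<alpha> \<gamma> (ev f \<alpha> + ev g \<alpha>) = ev f \<gamma> + ev g \<gamma>" for f g
    using transfer_ev[OF assms(1,2), of "f + g"] by simp
  moreover have "transfer \<alpha> \<gamma> 1 = 1"
    using transfer_ev[OF assms(1,2), of 1] by simp
  ultimately show ?thesis
    unfolding ring_hom_field_of_iff using assms(3) by (auto simp: pure_gen_def)
qed

lemma transfer_iso:
  fixes \<alpha> :: "'a::field_char_0" and \<gamma> :: "'b::field_char_0"
  assumes "\<alpha> ^ p = of_int m" "\<gamma> ^ p = of_int m"
  shows "field_of (pure_gen \<alpha>) \<simeq> field_of (pure_gen \<gamma>)"
proof -
  have "transfer \<alpha> \<gamma> \<in> Ring.ring_hom (field_of (pure_gen \<alpha>)) (field_of (pure_gen \<gamma>))"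
    by (rule transfer_hom[OF assms]) (simp add: pure_gen_def)
  moreover have "bij_betw (transfer \<alpha> \<gamma>) (pure_gen \<alpha>) (pure_gen \<gamma>)"
    by (rule bij_betw_byWitness[where f' = "transfer \<gamma> \<alpha>"])
       (auto simp: pure_gen_def transfer_ev[OF assms] transfer_ev[OF assms(2,1)])
  ultimately show ?thesis
    unfolding is_ring_iso_def ring_iso_def by auto
qed

text \<open>An embedding is determined by the image of \<alpha>, and every complex root of
  \<open>m\<close> occurs as such an image. Restriction matches the extensionality demanded of
  embeddings.\<close>

lemma embeddings_eq:
  assumes "\<alpha> ^ p = of_int m"
  shows "bij_betw (\<lambda>z. restrict (transfer \<alpha> z) (pure_gen \<alpha>)) {z::complex. z ^ p = of_int m}
           (embeddings (pure_gen \<alpha>))"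
proof (rule bij_betw_byWitness[where f' = "\<lambda>\<sigma>. \<sigma> \<alpha>"])
  let ?K = "pure_gen \<alpha>"
  have tr: "transfer \<alpha> z (ev f \<alpha>) = ev f z" if "z ^ p = of_int m" for f and z :: complex
    by (rule transfer_ev[OF assms that])
  have \<alpha>: "ev [:0, 1:] \<alpha> = \<alpha>" "ev [:0, 1:] z = z" for z :: complex by simp_all
  show "\<forall>z\<in>{z::complex. z ^ p = of_int m}. restrict (transfer \<alpha> z) ?K \<alpha> = z"
    using tr[of _ "[:0, 1:]"] by (simp add: pure_gen_self)
  have hom: "\<sigma> (ev f \<alpha>) = ev f (\<sigma> \<alpha>)" if "\<sigma> \<in> embeddings ?K" for \<sigma> f
    using that ring_hom_ev[of \<sigma> \<alpha> UNIV] by (simp add: embeddings_def)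
  have root: "\<sigma> \<alpha> ^ p = of_int m" if "\<sigma> \<in> embeddings ?K" for \<sigma>
    using hom[OF that, of "monom 1 p"] hom[OF that, of "[:of_int m:]"] by (simp add: assms)
  show "\<forall>\<sigma>\<in>embeddings ?K. restrict (transfer \<alpha> (\<sigma> \<alpha>)) ?K = \<sigma>"
  proof
    fix \<sigma> assume s: "\<sigma> \<in> embeddings ?K"
    show "restrict (transfer \<alpha> (\<sigma> \<alpha>)) ?K = \<sigma>"
    proof
      fix x
      show "restrict (transfer \<alpha> (\<sigma> \<alpha>)) ?K x = \<sigma> x"
      proof (cases "x \<in> ?K")
        case True
        then obtain f where "x = ev f \<alpha>" by (auto simp: pure_gen_def)
        then show ?thesis using True tr[OF root[OF s]] hom[OF s] by simp
      next
        case False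
        then show ?thesis using s by (auto simp: embeddings_def extensional_def)
      qed
    qed
  qed
  show "(\<lambda>z. restrict (transfer \<alpha> z) ?K) ` {z::complex. z ^ p = of_int m} \<subseteq> embeddings ?K"
  proof (rule image_subsetI)
    fix z :: complex assume "z \<in> {z. z ^ p = of_int m}"
    then have "transfer \<alpha> z \<in> Ring.ring_hom (field_of ?K) (field_of UNIV)"
      by (intro transfer_hom assms) auto
    then show "restrict (transfer \<alpha> z) ?K \<in> embeddings ?K"
      unfolding embeddings_def Int_iff ring_hom_field_of_iff
      by (simp add: pure_gen_mult pure_gen_add pure_gen_1)
  qed
  show "(\<lambda>\<sigma>. \<sigma> \<alpha>) ` embeddings ?K \<subseteq> {z::complex. z ^ p = of_int m}"
    using root by auto
qed

end

section \<open>Trace and inner product in the power basis\<close>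

interpretation rat_vs: vector_space "\<lambda>(q::rat) (x::'a::field_char_0). of_rat q * x"
  by unfold_locales (simp_all add: of_rat_add of_rat_mult algebra_simps)

interpretation int_mod: Modules.module "\<lambda>(k::int) (x::'a::comm_ring_1). of_int k * x"
  by unfold_locales (simp_all add: algebra_simps)

context pure_radicand
begin

abbreviation "roots \<equiv> {z::complex. z ^ p = of_int m}"

text \<open>The squared absolute value of every conjugate of a root of \<open>m\<close>.\<close>

definition w :: real where
  "w = root p \<bar>of_int m\<bar> ^ 2"

lemma w_pos: "w > 0"
  unfolding w_def by (intro zero_less_power real_root_gt_zero) simp_all

lemma root_power_p: "root p \<bar>of_int m\<bar> ^ p = \<bar>of_int m\<bar>"
  by (simp add: real_root_pow_pos2)

lemma w_power: "w ^ p = of_int (m\<^sup>2)"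
proof -
  have "w ^ p = (root p \<bar>of_int m\<bar> ^ p) ^ 2"
    unfolding w_def by (metis power_mult mult.commute)
  then show ?thesis unfolding root_power_p by simp
qed

lemma finite_roots: "finite roots" and card_roots: "card roots = p"
  using card_nth_roots[of "of_int m" p] by (auto intro: card_ge_0_finite)

lemma norm_root: "z \<in> roots \<Longrightarrow> z * cnj z = of_real w"
proof -
  assume "z \<in> roots"
  then have "cmod (z ^ p) = \<bar>of_int m\<bar>" by simp
  then have "cmod z = root p \<bar>of_int m\<bar>"
    by (metis norm_power norm_ge_zero p_gt_0 real_root_power_cancel)
  then show ?thesis by (simp add: complex_norm_square[symmetric] w_def flip: of_real_power)
qed

lemma sum_roots_orthogonal:
  assumes "i < p" "j < p"
  shows "(\<Sum>z\<in>roots. z ^ i * cnj z ^ j) = (if i = j then of_nat p * of_real (w ^ i) else 0)"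
proof (cases "i = j")
  case True
  have "(\<Sum>z\<in>roots. z ^ i * cnj z ^ i) = (\<Sum>z\<in>roots. of_real (w ^ i))"
    by (intro sum.cong refl) (simp only: norm_root of_real_power flip: power_mult_distrib)
  with True show ?thesis by (simp add: card_roots)
next
  case False
  define c where "c = cis (2 * pi / p)"
  have cp: "c ^ p = 1"
    unfolding c_def by (simp add: DeMoivre cis_2pi)
  have cc: "c * cnj c = 1"
    by (simp add: c_def complex_norm_square[symmetric])
  then have c0: "c \<noteq> 0" by auto
  have ne: "c ^ i \<noteq> c ^ j"
  proof
    assume "c ^ i = c ^ j"
    then have "cis (2 * pi * real i / p) = cis (2 * pi * real j / p)"
      by (simp add: c_def DeMoivre mult_ac)
    with bij_betw_roots_unity[OF p_gt_0] assms False show False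
      by (auto simp: bij_betw_def inj_on_def)
  qed
  let ?S = "\<Sum>z\<in>roots. z ^ i * cnj z ^ j"
  \<comment> \<open>Multiplication by a primitive root of unity permutes the roots, which scales the sum by a
    factor different from 1.\<close>
  have "bij_betw (\<lambda>z. c * z) roots roots"
    by (rule bij_betw_byWitness[where f' = "\<lambda>z. cnj c * z"])
       (use cp cc in \<open>auto simp: power_mult_distrib mult.assoc[symmetric] mult.commute[of "cnj c"]
          simp flip: complex_cnj_power\<close>)
  then have "?S = (\<Sum>z\<in>roots. (c * z) ^ i * cnj (c * z) ^ j)"
    by (rule sum.reindex_bij_betw[symmetric])
  also have "\<dots> = c ^ i * cnj c ^ j * ?S"
    by (simp add: sum_distrib_left power_mult_distrib ac_simps)
  \<comment> \<open>The extra factor \<open>c ^ j\<close> cancels \<open>cnj c ^ j\<close>, because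
    \<open>c * cnj c = 1\<close>.\<close>
  finally have "c ^ j * ?S = c ^ j * (c ^ i * cnj c ^ j * ?S)" by simp
  also have "\<dots> = (c * cnj c) ^ j * c ^ i * ?S"
    by (simp add: power_mult_distrib ac_simps)
  finally have "(c ^ j - c ^ i) * ?S = 0" by (simp add: cc algebra_simps)
  with ne False show ?thesis by simp
qed

text \<open>This has three uses: \<open>g = 1\<close> gives the trace, \<open>g = monom 1 i\<close>
  isolates one coefficient, and general \<open>g\<close> gives the inner products.\<close>

lemma sum_roots_ev:
  assumes "degree f < p" "degree g < p"
  shows "(\<Sum>z\<in>roots. ev f z * cnj (ev g z)) =
    of_nat p * of_real (\<Sum>i<p. of_rat (coeff f i * coeff g i) * w ^ i)"
proof -
  have cnj_rat: "cnj (of_rat q) = of_rat q" for q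
    by (cases q) (simp add: of_rat_rat)
  have "(\<Sum>z\<in>roots. ev f z * cnj (ev g z)) =
      (\<Sum>z\<in>roots. \<Sum>i<p. \<Sum>j<p. of_rat (coeff f i) * of_rat (coeff g j) * (z ^ i * cnj z ^ j))"
    by (simp add: ev_eq_sum[OF assms(1)] ev_eq_sum[OF assms(2)] sum_product cnj_rat ac_simps)
  also have "\<dots> = (\<Sum>i<p. \<Sum>j<p. of_rat (coeff f i) * of_rat (coeff g j) * (\<Sum>z\<in>roots. z ^ i * cnj z ^ j))"
    by (subst sum.swap, rule sum.cong[OF refl], subst sum.swap) (simp add: sum_distrib_left)
  also have "\<dots> = (\<Sum>i<p. \<Sum>j<p. if i = j then
      of_rat (coeff f i) * of_rat (coeff g i) * (of_nat p * of_real (w ^ i)) else 0)"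
    by (intro sum.cong refl) (simp add: sum_roots_orthogonal)
  also have "\<dots> = (\<Sum>i<p. of_rat (coeff f i) * of_rat (coeff g i) * (of_nat p * of_real (w ^ i)))"
    by simp
  also have "\<dots> = of_nat p * of_real (\<Sum>i<p. of_rat (coeff f i * coeff g i) * w ^ i)"
  proof -
    have "complex_of_real (real_of_rat q) = of_rat q" for q
      by (cases q) (simp add: of_rat_rat)
    then show ?thesis
      unfolding of_real_sum sum_distrib_left
      by (intro sum.cong refl) (simp add: of_rat_mult mult.commute)
  qed
  finally show ?thesis .
qed

end

locale pure_element = pure_radicand +
  fixes \<alpha> :: "'a::field_char_0"
  assumes root_\<alpha>: "\<alpha> ^ p = of_int m"
begin

abbreviation "K \<equiv> pure_gen \<alpha>"

lemma K_cases:
  assumes "x \<in> K"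
  obtains f where "degree f < p" "x = ev f \<alpha>"
proof -
  obtain f where "x = ev f \<alpha>" using assms by (auto simp: pure_gen_def)
  then show ?thesis
    using that[of "f mod pure_poly p m"] by (simp add: ev_mod root_\<alpha> degree_mod)
qed

lemma ev_in_K: "ev f \<alpha> \<in> K"
  by (simp add: pure_gen_def)

text \<open>\<open>F\<close> receives the whole map from polynomials to values, because an inner
  product evaluates two polynomials under the same embedding.\<close>

lemma sum_embeddings: "(\<Sum>\<sigma>\<in>embeddings K. F (\<lambda>f. \<sigma> (ev f \<alpha>))) = (\<Sum>z\<in>roots. F (\<lambda>f. ev f z))"
proof -
  have "(\<Sum>\<sigma>\<in>embeddings K. F (\<lambda>f. \<sigma> (ev f \<alpha>))) =
      (\<Sum>z\<in>roots. F (\<lambda>f. restrict (transfer \<alpha> z) K (ev f \<alpha>)))"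
    by (rule sum.reindex_bij_betw[OF embeddings_eq[OF root_\<alpha>], symmetric])
  also have "\<dots> = (\<Sum>z\<in>roots. F (\<lambda>f. ev f z))"
    by (intro sum.cong refl) (simp add: ev_in_K transfer_ev[OF root_\<alpha>])
  finally show ?thesis .
qed

lemma finite_embeddings: "finite (embeddings K)" and card_embeddings: "card (embeddings K) = p"
  using bij_betw_finite[OF embeddings_eq[OF root_\<alpha>]] bij_betw_same_card[OF embeddings_eq[OF root_\<alpha>]]
    finite_roots card_roots by auto

text \<open>The trace is the inner product with 1, and 1 is orthogonal to the other powers of
  \<alpha>.\<close>

lemma field_trace_ev: "degree f < p \<Longrightarrow> field_trace K (ev f \<alpha>) = of_nat p * coeff f 0"
proof -
  assume f: "degree f < p"
  have "(\<Sum>\<sigma>\<in>embeddings K. \<sigma> (ev f \<alpha>)) = (\<Sum>z\<in>roots. ev f z * cnj (ev 1 z))"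
    using sum_embeddings[of "\<lambda>h. h f"] by simp
  also have "\<dots> = of_nat p * of_real (\<Sum>i<p. of_rat (coeff f i * coeff 1 i) * w ^ i)"
    by (rule sum_roots_ev[OF f]) simp
  also have "(\<Sum>i<p. of_rat (coeff f i * coeff 1 i) * w ^ i) = (\<Sum>i<p. if i = 0 then of_rat (coeff f 0) else 0)"
    by (intro sum.cong) auto
  also have "\<dots> = real_of_rat (coeff f 0)" by simp
  also have "of_nat p * complex_of_real \<dots> = of_rat (of_nat p * coeff f 0)"
    by (cases "coeff f 0") (simp add: of_rat_mult of_rat_rat)
  finally have "(\<Sum>\<sigma>\<in>embeddings K. \<sigma> (ev f \<alpha>)) = of_rat (of_nat p * coeff f 0)" .
  then show ?thesis
    unfolding field_trace_def by (intro the_equality) simp_all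
qed

lemma subspace_K: "rat_vs.subspace K"
  unfolding rat_vs.subspace_def
  by (auto intro: pure_gen_0 pure_gen_add pure_gen_mult pure_gen_of_rat)

lemma
  shows independent_powers: "rat_vs.independent ((\<lambda>i. \<alpha> ^ i) ` {..<p})" (is "rat_vs.independent ?B")
    and card_powers: "card ((\<lambda>i. \<alpha> ^ i) ` {..<p}) = p"
    and span_powers: "rat_vs.span ((\<lambda>i. \<alpha> ^ i) ` {..<p}) = K"
proof -
  have inj: "inj_on (\<lambda>i. \<alpha> ^ i) {..<p}"
  proof (rule inj_onI)
    fix i j assume ij: "i \<in> {..<p}" "j \<in> {..<p}" "\<alpha> ^ i = \<alpha> ^ j"
    then have "monom (1::rat) i = monom 1 j"
      by (intro ev_inj[OF root_\<alpha>]) (simp_all add: degree_monom_eq)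
    then show "i = j" by (metis degree_monom_eq zero_neq_one)
  qed
  then show "card ?B = p" by (simp add: card_image)
  show "rat_vs.independent ?B"
  proof
    assume "rat_vs.dependent ?B"
    then obtain u v where u: "v \<in> ?B" "u v \<noteq> 0" "(\<Sum>v\<in>?B. of_rat (u v) * v) = 0"
      unfolding rat_vs.dependent_finite[OF finite_imageI[OF finite_lessThan]] by blast
    then have "(\<Sum>i<p. of_rat (u (\<alpha> ^ i)) * \<alpha> ^ i) = 0"
      by (simp add: sum.reindex[OF inj])
    from power_independent[OF root_\<alpha> this] u(1,2) show False by auto
  qed
  show "rat_vs.span ?B = K"
  proof (intro antisym rat_vs.span_minimal subspace_K subsetI)
    fix x assume "x \<in> K"
    then obtain f where f: "degree f < p" "x = ev f \<alpha>" by (rule K_cases)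
    show "x \<in> rat_vs.span ?B"
      unfolding f(2) ev_eq_sum[OF f(1)]
      by (intro rat_vs.span_sum rat_vs.span_scale rat_vs.span_base) auto
  qed (auto intro: pure_gen_power pure_gen_self)
qed

lemma field_degree_K: "field_degree K = p"
  using rat_vs.dim_eq_card_independent[OF independent_powers] rat_vs.dim_span[of "(\<lambda>i. \<alpha> ^ i) ` {..<p}"]
  unfolding span_powers card_powers field_degree_def by simp

lemma perp_ev: "degree f < p \<Longrightarrow> perp K (ev f \<alpha>) = ev (smult (of_nat p) (f - [:coeff f 0:])) \<alpha>"
  by (simp add: perp_def field_degree_K field_trace_ev of_rat_mult algebra_simps)

end

section \<open>Shapes and isomorphisms\<close>

text \<open>Replaces coefficients indexed by elements with coefficients indexed by positions.
  Independence over positions already implies distinctness.\<close>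

lemma is_Z_basis_iff:
  "is_Z_basis bs M \<longleftrightarrow>
     (\<forall>k::nat \<Rightarrow> int. (\<Sum>i<length bs. of_int (k i) * bs ! i) = 0 \<longrightarrow> (\<forall>i<length bs. k i = 0)) \<and>
     int_lin {..<length bs} (\<lambda>i. bs ! i) = M"
  (is "_ \<longleftrightarrow> ?I \<and> ?S")
proof -
  let ?n = "length bs"
  have dist: "distinct bs" if "?I"
  proof (rule ccontr)
    assume "\<not> distinct bs"
    then obtain i j where ij: "i < ?n" "j < ?n" "i \<noteq> j" "bs ! i = bs ! j"
      by (auto simp: distinct_conv_nth)
    \<comment> \<open>A repeated entry gives the nontrivial relation
      \<open>bs ! i - bs ! j = 0\<close>.\<close>
    let ?k = "\<lambda>l. (if l = i then 1 else 0) - (if l = j then 1 else (0::int))"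
    have "(\<Sum>l<?n. of_int (?k l) * bs ! l) =
        (\<Sum>l<?n. if l = i then bs ! i else 0) - (\<Sum>l<?n. if l = j then bs ! j else 0)"
      by (subst sum_subtractf[symmetric]) (intro sum.cong refl, auto)
    also have "\<dots> = 0" using ij by simp
    finally have "?k i = 0" by (rule that[rule_format, of ?k i, OF _ ij(1)])
    then show False using ij(3) by simp
  qed
  show ?thesis
  proof (cases "distinct bs")
    case True
    then have bij: "bij_betw ((!) bs) {..<?n} (set bs)"
      by (intro bij_betw_nth) auto
    have sum: "(\<Sum>v\<in>set bs. of_int (u v) * v) = (\<Sum>i<?n. of_int (u (bs ! i)) * bs ! i)" for u :: "'a \<Rightarrow> int"
      by (rule sum.reindex_bij_betw[OF bij, symmetric])
    define idx where "idx = the_inv_into {..<?n} ((!) bs)"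
    have idx: "idx (bs ! i) = i" if "i < ?n" for i
      using bij that unfolding idx_def bij_betw_def by (auto intro: the_inv_into_f_f)
    have sum': "(\<Sum>i<?n. of_int (k i) * bs ! i) = (\<Sum>v\<in>set bs. of_int (k (idx v)) * v)" for k :: "nat \<Rightarrow> int"
      unfolding sum by (intro sum.cong refl) (simp add: idx)
    have "\<not> int_mod.dependent (set bs) \<longleftrightarrow>
        (\<forall>u. (\<Sum>v\<in>set bs. of_int (u v) * v) = 0 \<longrightarrow> (\<forall>v\<in>set bs. u v = 0))"
      unfolding int_mod.dependent_finite[OF finite_set] by metis
    also have "\<dots> \<longleftrightarrow> ?I"
    proof (intro iffI allI impI)
      fix k i assume a: "\<forall>u. (\<Sum>v\<in>set bs. of_int (u v) * v) = 0 \<longrightarrow> (\<forall>v\<in>set bs. u v = 0)"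
        "(\<Sum>i<?n. of_int (k i) * bs ! i) = 0" "i < ?n"
      have "k (idx (bs ! i)) = 0"
        by (rule a(1)[rule_format, of "\<lambda>v. k (idx v)"]) (use a(2,3) sum' in auto)
      then show "k i = 0" using idx[OF a(3)] by simp
    next
      fix u assume a: "?I" "(\<Sum>v\<in>set bs. of_int (u v) * v) = 0"
      show "\<forall>v\<in>set bs. u v = 0"
      proof
        fix v assume "v \<in> set bs"
        then obtain i where i: "i < ?n" "v = bs ! i" by (auto simp: in_set_conv_nth)
        show "u v = 0"
          unfolding i(2) by (rule a(1)[rule_format, of "\<lambda>i. u (bs ! i)", OF _ i(1)]) (use a(2) sum in simp)
      qed
    qed
    finally have "\<not> int_mod.dependent (set bs) \<longleftrightarrow> ?I" .
    moreover have "int_mod.span (set bs) = int_lin {..<?n} (\<lambda>i. bs ! i)"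
      unfolding int_mod.span_finite[OF finite_set] int_lin_def
    proof (intro antisym image_subsetI)
      show "(\<Sum>v\<in>set bs. of_int (u v) * v) \<in> range (\<lambda>k::nat \<Rightarrow> int. \<Sum>i<?n. of_int (k i) * bs ! i)" for u
        unfolding sum by (rule range_eqI[of _ _ "\<lambda>i. u (bs ! i)"]) simp
      show "(\<Sum>i<?n. of_int (k i) * bs ! i) \<in> range (\<lambda>u. \<Sum>v\<in>set bs. of_int (u v) * v)" for k :: "nat \<Rightarrow> int"
        unfolding sum' by (rule range_eqI[of _ _ "\<lambda>v. k (idx v)"]) simp
    qed
    ultimately show ?thesis unfolding is_Z_basis_def using True by auto
  next
    case False
    with dist show ?thesis by (auto simp: is_Z_basis_def)
  qed
qed

text \<open>A sum over the set of embeddings is independent of their numbering. The cardinality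
  assumption makes the chosen list exactly as long as the vectors.\<close>

lemma minkowski_inner:
  assumes "finite (embeddings K)" "card (embeddings K) = field_degree K"
  shows "minkowski K x \<bullet>c minkowski K y = (\<Sum>\<sigma>\<in>embeddings K. \<sigma> x * cnj (\<sigma> y))"
proof -
  have "\<exists>\<sigma>s. distinct \<sigma>s \<and> set \<sigma>s = embeddings K"
    using finite_distinct_list[OF assms(1)] by blast
  then have l: "distinct (embedding_list K)" "set (embedding_list K) = embeddings K"
    unfolding embedding_list_def by (metis (mono_tags, lifting) someI_ex)+
  then have "length (embedding_list K) = field_degree K"
    using assms(2) distinct_card by metis
  then have "bij_betw ((!) (embedding_list K)) {..<field_degree K} (embeddings K)"
    using l by (intro bij_betw_nth) auto
  from sum.reindex_bij_betw[OF this, of "\<lambda>\<sigma>. \<sigma> x * cnj (\<sigma> y)"] show ?thesis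
    by (simp add: minkowski_def scalar_prod_def lessThan_atLeast0)
qed

section \<open>Transport of lattice bases between roots of the same radicand\<close>

lemma ev_pcompose [simp]: "ev (pcompose f g) x = ev f (ev g x)"
  by (induction f) (simp_all add: pcompose_pCons)

lemma ev_of_int_poly: "ev (map_poly of_int q) x = poly (map_poly of_int q) x"
  by (simp add: ev_def map_poly_map_poly o_def)

text \<open>An integral equation \<open>q\<close> for \<open>ev f \<alpha>\<close> is a relation for
  \<alpha> itself, namely the vanishing of \<open>q\<close> composed with \<open>f\<close>; it
  therefore holds at every root of \<open>m\<close>.\<close>

lemma (in pure_radicand) algebraic_int_transfer:
  assumes "\<alpha> ^ p = of_int m" "\<gamma> ^ p = of_int m" "algebraic_int (ev f \<alpha>)"
  shows "algebraic_int (ev f \<gamma>)"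
proof -
  obtain q :: "int poly" where q: "poly (map_poly of_int q) (ev f \<alpha>) = 0" "lead_coeff q = 1"
    using assms(3) unfolding algebraic_int_altdef_ipoly by blast
  have "ev (pcompose (map_poly of_int q) f) \<alpha> = ev 0 \<alpha>"
    using q(1) by (simp add: ev_of_int_poly)
  from ev_transfer[OF assms(1,2) this] have "poly (map_poly of_int q) (ev f \<gamma>) = 0"
    by (simp add: ev_of_int_poly)
  with q(2) show ?thesis unfolding algebraic_int_altdef_ipoly by blast
qed

context pure_element
begin

lemma gram_form:
  assumes "degree f < p" "degree g < p"
  shows "minkowski K (ev f \<alpha>) \<bullet>c minkowski K (ev g \<alpha>) =
    of_nat p * of_real (\<Sum>i<p. of_rat (coeff f i * coeff g i) * w ^ i)"
  using minkowski_inner[of K] finite_embeddings card_embeddings field_degree_K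
    sum_embeddings[of "\<lambda>h. h f * cnj (h g)"] sum_roots_ev[OF assms]
  by simp

lemma ring_of_integers_iff: "ev f \<alpha> \<in> ring_of_integers K \<longleftrightarrow> algebraic_int (ev f \<alpha>)"
  by (simp add: ring_of_integers_def ev_in_K)

lemma integers_perp_eq:
  "integers_perp K = {ev (smult (of_nat p) (f - [:coeff f 0:])) \<alpha> | f. degree f < p \<and> algebraic_int (ev f \<alpha>)}"
proof (intro equalityI subsetI)
  fix x assume "x \<in> integers_perp K"
  then obtain y where y: "x = perp K y" "y \<in> ring_of_integers K"
    by (auto simp: integers_perp_def)
  then have "y \<in> K" by (simp add: ring_of_integers_def)
  then obtain f where f: "degree f < p" "y = ev f \<alpha>" by (rule K_cases)
  with y show "x \<in> {ev (smult (of_nat p) (f - [:coeff f 0:])) \<alpha> | f. degree f < p \<and> algebraic_int (ev f \<alpha>)}"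
    by (auto simp only: ring_of_integers_iff perp_ev[OF f(1)])
next
  fix x assume "x \<in> {ev (smult (of_nat p) (f - [:coeff f 0:])) \<alpha> | f. degree f < p \<and> algebraic_int (ev f \<alpha>)}"
  then obtain f where f: "x = ev (smult (of_nat p) (f - [:coeff f 0:])) \<alpha>" "degree f < p" "algebraic_int (ev f \<alpha>)"
    by blast
  then show "x \<in> integers_perp K"
    unfolding integers_perp_def using perp_ev[OF f(2)] ring_of_integers_iff f(1,3) by (intro image_eqI[of _ _ "ev f \<alpha>"]) simp_all
qed

lemma integers_perp_subset: "integers_perp K \<subseteq> K"
  unfolding integers_perp_eq using ev_in_K by blast

end

text \<open>The basis is written in polynomials and these are evaluated at \<gamma>. Linear
  relations, integrality and Gram entries depend only on the polynomials.\<close>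

lemma (in pure_radicand) Z_basis_transfer:
  fixes \<alpha> :: "'a::field_char_0" and \<gamma> :: "'b::field_char_0"
  assumes "\<alpha> ^ p = of_int m" "\<gamma> ^ p = of_int m"
    and bs: "is_Z_basis bs (integers_perp (pure_gen \<alpha>))"
  obtains bs' where "is_Z_basis bs' (integers_perp (pure_gen \<gamma>))"
    "gram_matrix (pure_gen \<gamma>) bs' = gram_matrix (pure_gen \<alpha>) bs"
proof -
  interpret A: pure_element p m \<alpha> by unfold_locales fact
  interpret C: pure_element p m \<gamma> by unfold_locales fact
  let ?M = "integers_perp A.K" and ?M' = "integers_perp C.K"
  let ?n = "length bs"
  have span: "int_lin {..<?n} (\<lambda>i. bs ! i) = ?M"
    and indep: "\<And>k::nat \<Rightarrow> int. (\<Sum>i<?n. of_int (k i) * bs ! i) = 0 \<Longrightarrow> (\<forall>i<?n. k i = 0)"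
    using bs unfolding is_Z_basis_iff by auto
  have "bs ! i \<in> A.K" if "i < ?n" for i
    using int_lin_gen[of "{..<?n}" i "(!) bs"] that span A.integers_perp_subset by auto
  then have "\<forall>i. \<exists>f. i < ?n \<longrightarrow> degree f < p \<and> bs ! i = ev f \<alpha>"
    by (meson A.K_cases)
  then obtain F where F: "\<And>i. i < ?n \<Longrightarrow> degree (F i) < p" "\<And>i. i < ?n \<Longrightarrow> bs ! i = ev (F i) \<alpha>"
    by metis
  define bs' where "bs' = map (\<lambda>i. ev (F i) \<gamma>) [0..<?n]"
  have n': "length bs' = ?n" and nth': "\<And>i. i < ?n \<Longrightarrow> bs' ! i = ev (F i) \<gamma>"
    by (simp_all add: bs'_def)
  \<comment> \<open>An integer combination is packed into a single polynomial, so that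
    \<open>ev_transfer\<close> applies to it as a whole.\<close>
  define S where "S k = (\<Sum>i<?n. smult (of_int (k i)) (F i))" for k :: "nat \<Rightarrow> int"
  have ev_sum: "ev (S k) x = (\<Sum>i<?n. of_int (k i) * ev (F i) x)" for k and x :: "'c::field_char_0"
    unfolding S_def by (induction ("?n")) simp_all
  have S: "(\<Sum>i<?n. of_int (k i) * bs ! i) = ev (S k) \<alpha>" for k
    unfolding ev_sum by (intro sum.cong refl) (simp add: F)
  have S': "(\<Sum>i<?n. of_int (k i) * bs' ! i) = ev (S k) \<gamma>" for k
    unfolding ev_sum by (intro sum.cong refl) (simp add: nth')
  have dS: "degree (S k) < p" for k
    unfolding S_def by (intro degree_sum_less p_gt_0) (use F(1) degree_smult_le le_less_trans in blast)
  have "is_Z_basis bs' ?M'"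
    unfolding is_Z_basis_iff n'
  proof (intro conjI allI impI)
    fix k :: "nat \<Rightarrow> int" and i
    assume "(\<Sum>i<?n. of_int (k i) * bs' ! i) = 0" "i < ?n"
    then have "ev (S k) \<gamma> = ev 0 \<gamma>" unfolding S' by simp
    from ev_transfer[OF assms(2,1) this] have "ev (S k) \<alpha> = 0" by simp
    with indep[of k] show "k i = 0" unfolding S using \<open>i < ?n\<close> by blast
  next
    let ?G = "\<lambda>f. smult (of_nat p) (f - [:coeff f 0:])"
    have *: "ev g \<alpha> \<in> ?M \<longleftrightarrow> ev g \<gamma> \<in> ?M'" for g
    proof -
      have "(\<exists>f. ev g \<alpha> = ev (?G f) \<alpha> \<and> degree f < p \<and> algebraic_int (ev f \<alpha>)) \<longleftrightarrow>
            (\<exists>f. ev g \<gamma> = ev (?G f) \<gamma> \<and> degree f < p \<and> algebraic_int (ev f \<gamma>))"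
        using ev_transfer[OF assms(1,2)] ev_transfer[OF assms(2,1)]
          algebraic_int_transfer[OF assms(1,2)] algebraic_int_transfer[OF assms(2,1)]
        by blast
      then show ?thesis unfolding A.integers_perp_eq C.integers_perp_eq by blast
    qed
    show "int_lin {..<?n} ((!) bs') = ?M'"
    proof (intro equalityI subsetI)
      fix x assume "x \<in> int_lin {..<?n} ((!) bs')"
      then obtain k where x: "x = ev (S k) \<gamma>" unfolding int_lin_def S' by blast
      have "ev (S k) \<alpha> \<in> ?M" unfolding span[symmetric] int_lin_def S by blast
      then show "x \<in> ?M'" unfolding x * .
    next
      fix x assume x: "x \<in> ?M'"
      then obtain g where g: "x = ev g \<gamma>" unfolding C.integers_perp_eq by blast
      with x have "ev g \<alpha> \<in> ?M" unfolding * by simp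
      then obtain k where "ev g \<alpha> = ev (S k) \<alpha>" unfolding span[symmetric] int_lin_def S by blast
      then have "x = ev (S k) \<gamma>" unfolding g by (rule ev_transfer[OF assms(1,2)])
      then show "x \<in> int_lin {..<?n} ((!) bs')" unfolding int_lin_def S' by blast
    qed
  qed
  moreover have "gram_matrix C.K bs' = gram_matrix A.K bs"
    unfolding gram_matrix_def n'
    by (intro cong_mat refl) (simp add: nth' F A.gram_form C.gram_form)
  ultimately show ?thesis by (rule that)
qed

lemma (in pure_radicand) shape_transfer:
  fixes \<alpha> :: "'a::field_char_0" and \<gamma> :: "'b::field_char_0"
  assumes "\<alpha> ^ p = of_int m" "\<gamma> ^ p = of_int m"
  shows "shape (pure_gen \<alpha>) = shape (pure_gen \<gamma>)"
proof -
  interpret A: pure_element p m \<alpha> by unfold_locales fact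
  interpret C: pure_element p m \<gamma> by unfold_locales fact
  have "{gram_matrix A.K bs | bs. is_Z_basis bs (integers_perp A.K)} =
        {gram_matrix C.K bs | bs. is_Z_basis bs (integers_perp C.K)}"
  proof (intro equalityI subsetI; clarify)
    fix bs assume "is_Z_basis bs (integers_perp A.K)"
    then show "\<exists>bs'. gram_matrix A.K bs = gram_matrix C.K bs' \<and> is_Z_basis bs' (integers_perp C.K)"
      using Z_basis_transfer[OF assms] by metis
  next
    fix bs assume "is_Z_basis bs (integers_perp C.K)"
    then show "\<exists>bs'. gram_matrix C.K bs = gram_matrix A.K bs' \<and> is_Z_basis bs' (integers_perp A.K)"
      using Z_basis_transfer[OF assms(2,1)] by metis
  qed
  then show ?thesis unfolding shape_def A.field_degree_K C.field_degree_K by simp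
qed

section \<open>A basis of the lattice\<close>

lemma int_lin_subset:
  assumes "0 \<in> M" "\<And>x y. x \<in> M \<Longrightarrow> y \<in> M \<Longrightarrow> x - y \<in> M" "\<And>i. i \<in> I \<Longrightarrow> b i \<in> M"
  shows "int_lin I b \<subseteq> M"
proof -
  have minus: "- x \<in> M" if "x \<in> M" for x
    using assms(2)[OF assms(1) that] by simp
  have add: "x + y \<in> M" if "x \<in> M" "y \<in> M" for x y
    using assms(2)[OF that(1) minus[OF that(2)]] by simp
  have nat: "of_nat n * x \<in> M" if "x \<in> M" for n x
    by (induction n) (simp_all add: assms(1) add that distrib_right)
  have int: "of_int k * x \<in> M" if "x \<in> M" for k x
    using nat[OF that] minus[OF nat[OF that]] by (cases k) (simp_all del: of_nat_Suc)
  have "(\<Sum>i\<in>J. of_int (k i) * b i) \<in> M" if "J \<subseteq> I" for k J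
    using that
  proof (induction J rule: infinite_finite_induct)
    case (insert i J)
    then show ?case using assms(3) by (simp add: add int)
  qed (simp_all add: assms(1))
  then show ?thesis unfolding int_lin_def by blast
qed

text \<open>Induction on the number of additive integer coordinates, which jointly separate elements
  from 0. An element whose last coordinate is positive and least reduces every other element to one
  whose last coordinate is 0.\<close>

lemma subgroup_generators:
  fixes M :: "'a::comm_ring_1 set" and c :: "nat \<Rightarrow> 'a \<Rightarrow> int"
  assumes "0 \<in> M" "\<And>x y. x \<in> M \<Longrightarrow> y \<in> M \<Longrightarrow> x - y \<in> M"
    and "\<And>i x y. x \<in> M \<Longrightarrow> y \<in> M \<Longrightarrow> c i (x - y) = c i x - c i y"
    and "\<And>x. x \<in> M \<Longrightarrow> (\<And>i. i < d \<Longrightarrow> c i x = 0) \<Longrightarrow> x = 0"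
  shows "\<exists>b. (\<forall>i<d. b i \<in> M) \<and> M \<subseteq> int_lin {..<d} b"
  using assms
proof (induction d arbitrary: M)
  case 0
  then have "M \<subseteq> {0}" by auto
  then show ?case by (auto simp: int_lin_def)
next
  case (Suc d)
  note M0 = Suc.prems(1) and Mdiff = Suc.prems(2) and c_diff = Suc.prems(3)
  have c0: "c i 0 = 0" for i using c_diff[OF M0 M0, of i] by simp
  define M' where "M' = {x \<in> M. c d x = 0}"
  have "\<exists>b. (\<forall>i<d. b i \<in> M') \<and> M' \<subseteq> int_lin {..<d} b"
  proof (rule Suc.IH)
    fix x assume x: "x \<in> M'" "\<And>i. i < d \<Longrightarrow> c i x = 0"
    show "x = 0"
      by (rule Suc.prems(4)) (use x in \<open>auto simp: M'_def less_Suc_eq\<close>)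
  qed (auto simp: M'_def M0 Mdiff c_diff c0)
  then obtain b where b: "\<And>i. i < d \<Longrightarrow> b i \<in> M'" "M' \<subseteq> int_lin {..<d} b" by blast
  have gen: "\<exists>g\<in>M. \<forall>x\<in>M. \<exists>q. x - of_int q * g \<in> M'"
  proof (cases "M \<subseteq> M'")
    case True
    \<comment> \<open>If the last coordinate vanishes on all of \<open>M\<close>, the generator 0
      keeps the number of generators at \<open>d + 1\<close>.\<close>
    then show ?thesis using M0 by (intro bexI[of _ 0]) auto
  next
    case False
    then obtain x0 where x0: "x0 \<in> M" "c d x0 \<noteq> 0" by (auto simp: M'_def)
    have "0 - x0 \<in> M" by (rule Mdiff[OF M0 x0(1)])
    moreover have "c d (0 - x0) = - c d x0"
      using c_diff[OF M0 x0(1)] c0 by simp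
    ultimately have "\<exists>n::nat. n > 0 \<and> (\<exists>x\<in>M. c d x = int n)"
      using x0 by (intro exI[of _ "nat \<bar>c d x0\<bar>"]) (auto simp: abs_if)
    then obtain n where n: "n > 0" "\<exists>x\<in>M. c d x = int n"
      and least: "\<And>k. k < n \<Longrightarrow> \<not> (k > 0 \<and> (\<exists>x\<in>M. c d x = int k))"
      using exists_least_iff[of "\<lambda>n. n > 0 \<and> (\<exists>x\<in>M. c d x = int n)"] by blast
    then obtain g where g: "g \<in> M" "c d g = int n" by blast
    \<comment> \<open>Closure and additivity are known only for differences, hence the induction on
      \<open>q\<close> in both directions.\<close>
    have step: "x - of_int q * g \<in> M \<and> c d (x - of_int q * g) = c d x - q * int n" if x: "x \<in> M" for x q
    proof -
      have g': "0 - g \<in> M" "c d (0 - g) = - int n"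
        using c_diff[OF M0 g(1)] c0 g(2) Mdiff[OF M0 g(1)] by simp_all
      show ?thesis
      proof (induction q rule: int_induct[of _ 0])
        case base
        then show ?case using x by simp
      next
        case (step1 i)
        then have "(x - of_int i * g) - g \<in> M \<and> c d ((x - of_int i * g) - g) = c d (x - of_int i * g) - c d g"
          using g Mdiff c_diff by blast
        with step1 g show ?case by (simp add: algebra_simps)
      next
        case (step2 i)
        then have "(x - of_int i * g) - (0 - g) \<in> M \<and>
            c d ((x - of_int i * g) - (0 - g)) = c d (x - of_int i * g) - c d (0 - g)"
          using g' Mdiff c_diff by blast
        with step2 g' show ?case by (simp add: algebra_simps)
      qed
    qed
    show ?thesis
    proof (intro bexI[of _ g] ballI exI)
      fix x assume "x \<in> M"
      \<comment> \<open>Division with remainder: the last coordinate of \<open>y\<close> lies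
        between 0 and \<open>n - 1\<close>, so minimality of \<open>n\<close> makes it 0.\<close>
      define y where "y = x - of_int (c d x div int n) * g"
      have y: "y \<in> M" "c d y = c d x mod int n"
        using step[OF \<open>x \<in> M\<close>, of "c d x div int n"] unfolding y_def
        by (auto simp: minus_div_mult_eq_mod)
      have r: "0 \<le> c d y" "c d y < int n" using y(2) n(1) by simp_all
      have "c d y = 0"
      proof (rule ccontr)
        assume "c d y \<noteq> 0"
        with r have "nat (c d y) > 0" "nat (c d y) < n" "c d y = int (nat (c d y))" by auto
        with least y(1) show False by blast
      qed
      with y(1) show "x - of_int (c d x div int n) * g \<in> M'" by (simp add: M'_def y_def)
    qed fact
  qed
  then obtain g where g: "g \<in> M" "\<And>x. x \<in> M \<Longrightarrow> \<exists>q. x - of_int q * g \<in> M'" by blast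
  show ?case
  proof (intro exI[of _ "b(d := g)"] conjI allI impI subsetI)
    fix i assume "i < Suc d"
    then show "(b(d := g)) i \<in> M" using b(1) g(1) by (auto simp: M'_def less_Suc_eq)
  next
    fix x assume "x \<in> M"
    then obtain q where "x - of_int q * g \<in> M'" using g(2) by blast
    then obtain k :: "nat \<Rightarrow> int" where k: "x - of_int q * g = (\<Sum>i<d. of_int (k i) * b i)"
      using b(2) by (auto simp: int_lin_def)
    have "x = (\<Sum>i<Suc d. of_int ((k(d := q)) i) * (b(d := g)) i)"
      using k by (simp add: algebra_simps)
    then show "x \<in> int_lin {..<Suc d} (b(d := g))" unfolding int_lin_def by (rule range_eqI[of _ _ "k(d := q)"])
  qed
qed

text \<open>A one-sided inverse of a square matrix is two-sided. The scalar \<open>c\<close> will be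
  \<open>p\<close>, as the lattice contains \<open>p * \<alpha> ^ Suc i\<close>.\<close>

lemma right_inverse_if_left_inverse:
  fixes N A :: "nat \<Rightarrow> nat \<Rightarrow> 'a::field"
  assumes "c \<noteq> 0" "\<And>i j. i < d \<Longrightarrow> j < d \<Longrightarrow> (\<Sum>k<d. N i k * A k j) = (if i = j then c else 0)"
    and "i < d" "j < d"
  shows "(\<Sum>k<d. A i k * N k j) = (if i = j then c else 0)"
proof -
  let ?N = "mat d d (\<lambda>(i, j). N i j)" and ?A = "mat d d (\<lambda>(i, j). A i j / c)"
  have "?N * ?A = 1\<^sub>m d"
    using assms(1,2) by (intro eq_matI) (simp_all add: scalar_prod_def lessThan_atLeast0 flip: sum_divide_distrib)
  then have "?A * ?N = 1\<^sub>m d"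
    by (intro mat_mult_left_right_inverse[of ?N d ?A]) simp_all
  then have "(?A * ?N) $$ (i, j) = 1\<^sub>m d $$ (i, j)" by simp
  then have "(\<Sum>k<d. A i k * N k j) / c = (if i = j then 1 else 0)"
    using assms(3,4) by (simp add: scalar_prod_def lessThan_atLeast0 sum_divide_distrib)
  then show ?thesis using assms(1) by (auto simp: field_simps split: if_splits)
qed

lemma of_rat_in_Ints_iff: "(of_rat q :: 'a::field_char_0) \<in> \<int> \<longleftrightarrow> q \<in> \<int>"
proof
  assume "(of_rat q :: 'a) \<in> \<int>"
  then obtain k where "(of_rat q :: 'a) = of_rat (of_int k)" by (auto elim: Ints_cases)
  then show "q \<in> \<int>" by (simp only: of_rat_eq_iff) simp
qed (auto elim!: Ints_cases)

section \<open>Denominators, coordinates and a Z-basis\<close>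

context pure_element
begin

lemma algebraic_int_root: "z ^ p = of_int m \<Longrightarrow> algebraic_int (z :: 'b::field_char_0)"
  by (rule Polynomial.algebraic_int_root[of "of_int m" "monom 1 p"])
     (auto simp: poly_monom degree_monom_eq int_imp_algebraic_int)

text \<open>Multiplication by \<open>\<alpha> ^ (p - i)\<close> moves the coefficient of index
  \<open>i\<close> to the constant term with a factor \<open>m\<close>, and a rational trace of an
  algebraic integer is an integer.\<close>

lemma coeff_denominator:
  assumes "algebraic_int (ev f \<alpha>)" "degree f < p" "i < p"
  shows "of_nat p * of_int m * coeff f i \<in> \<int>"
proof -
  \<comment> \<open>the trace of \<open>ev f \<alpha> * \<alpha> ^ (p - i)\<close>\<close>
  define S where "S = (\<Sum>z\<in>roots. ev f z * z ^ (p - i))"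
  have "algebraic_int (ev f z)" if "z \<in> roots" for z
    using algebraic_int_transfer[OF root_\<alpha> _ assms(1)] that by simp
  then have S: "algebraic_int S"
    unfolding S_def using algebraic_int_root
    by (intro algebraic_int_sum algebraic_int_times algebraic_int_power) auto
  have "S * of_real (w ^ i) = (\<Sum>z\<in>roots. of_int m * (ev f z * cnj (ev (monom 1 i) z)))"
    unfolding S_def sum_distrib_right
  proof (rule sum.cong)
    fix z assume z: "z \<in> roots"
    \<comment> \<open>Replacing \<open>w ^ i\<close> by \<open>z ^ i * cnj z ^ i\<close> turns the
      summand into \<open>m\<close> times an inner product term, to which the orthogonality of
      powers applies.\<close>
    have "z ^ (p - i) * of_real (w ^ i) = z ^ (p - i) * z ^ i * cnj z ^ i"
      by (simp add: norm_root[OF z, symmetric] power_mult_distrib)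
    also have "z ^ (p - i) * z ^ i = of_int m"
      using z assms(3) by (simp flip: power_add)
    finally show "ev f z * z ^ (p - i) * of_real (w ^ i) = of_int m * (ev f z * cnj (ev (monom 1 i) z))"
      by (simp add: ac_simps)
  qed simp
  also have "\<dots> = of_int m * (\<Sum>z\<in>roots. ev f z * cnj (ev (monom 1 i) z))"
    by (simp add: sum_distrib_left)
  also have "(\<Sum>z\<in>roots. ev f z * cnj (ev (monom 1 i) z)) =
      of_nat p * of_real (\<Sum>j<p. of_rat (coeff f j * coeff (monom 1 i) j) * w ^ j)"
    using assms(2,3) by (intro sum_roots_ev) (simp_all add: degree_monom_eq)
  also have "(\<Sum>j<p. of_rat (coeff f j * coeff (monom 1 i) j) * w ^ j) =
      (\<Sum>j<p. if j = i then of_rat (coeff f i) * w ^ i else 0)"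
    by (intro sum.cong) auto
  also have "\<dots> = of_rat (coeff f i) * w ^ i" using assms(3) by simp
  finally have "S * of_real (w ^ i) = of_int m * of_nat p * of_real (of_rat (coeff f i)) * of_real (w ^ i)"
    by (simp add: mult.assoc)
  moreover have "complex_of_real (w ^ i) \<noteq> 0" using w_pos by simp
  ultimately have "S = of_int m * of_nat p * of_real (of_rat (coeff f i))"
    using mult_right_cancel by blast
  also have "\<dots> = of_rat (of_nat p * of_int m * coeff f i)"
    by (cases "coeff f i") (simp add: of_rat_mult of_rat_rat)
  finally have "S = of_rat (of_nat p * of_int m * coeff f i)" .
  moreover from this have "S \<in> \<int>"
    using rational_algebraic_int_is_int[OF S] by simp
  ultimately show ?thesis using of_rat_in_Ints_iff by metis
qed

definition rep_poly :: "'a \<Rightarrow> rat poly" where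
  "rep_poly x = (SOME f. degree f < p \<and> x = ev f \<alpha>)"

lemma rep_ev: "degree f < p \<Longrightarrow> rep_poly (ev f \<alpha>) = f"
  unfolding rep_poly_def by (rule some_equality) (auto intro: ev_inj[OF root_\<alpha>])

lemma rep_poly:
  assumes "x \<in> K"
  shows degree_rep: "degree (rep_poly x) < p" and ev_rep: "ev (rep_poly x) \<alpha> = x"
proof -
  obtain f where "degree f < p" "x = ev f \<alpha>" using assms by (rule K_cases)
  then show "degree (rep_poly x) < p" "ev (rep_poly x) \<alpha> = x" by (simp_all add: rep_ev)
qed

text \<open>The index is shifted because trace zero elements have no constant coefficient.\<close>

definition coord :: "nat \<Rightarrow> 'a \<Rightarrow> rat" where
  "coord i x = coeff (rep_poly x) (Suc i)"

lemma coord_diff: "x \<in> K \<Longrightarrow> y \<in> K \<Longrightarrow> coord i (x - y) = coord i x - coord i y"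
proof -
  assume xy: "x \<in> K" "y \<in> K"
  then have "ev (rep_poly x - rep_poly y) \<alpha> = x - y" "degree (rep_poly x - rep_poly y) < p"
    by (simp_all add: degree_diff_less degree_rep ev_rep)
  then have "rep_poly (x - y) = rep_poly x - rep_poly y" using rep_ev by metis
  then show ?thesis by (simp add: coord_def)
qed

lemma coord_int_sum:
  fixes n :: nat
  assumes "\<And>j. j < n \<Longrightarrow> x j \<in> K"
  shows "coord i (\<Sum>j<n. of_int (k j) * x j) = (\<Sum>j<n. of_int (k j) * coord i (x j))"
proof -
  define S where "S = (\<Sum>j<n. smult (of_int (k j)) (rep_poly (x j)))"
  have "ev S \<alpha> = (\<Sum>j<n. of_int (k j) * x j)"
    using assms unfolding S_def by (induction n) (simp_all add: ev_rep)
  moreover have "degree S < p"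
    unfolding S_def by (intro degree_sum_less p_gt_0) (use assms degree_rep degree_smult_le le_less_trans in blast)
  ultimately have "rep_poly (\<Sum>j<n. of_int (k j) * x j) = S" using rep_ev by metis
  then show ?thesis by (simp add: coord_def S_def coeff_sum)
qed

abbreviation "M \<equiv> integers_perp K"

lemma M_in_K: "x \<in> M \<Longrightarrow> x \<in> K"
  using integers_perp_subset by blast

lemma M_cases:
  assumes "x \<in> M"
  obtains f where "degree f < p" "algebraic_int (ev f \<alpha>)"
    "x = ev (smult (of_nat p) (f - [:coeff f 0:])) \<alpha>" "rep_poly x = smult (of_nat p) (f - [:coeff f 0:])"
proof -
  obtain f where f: "degree f < p" "algebraic_int (ev f \<alpha>)"
    "x = ev (smult (of_nat p) (f - [:coeff f 0:])) \<alpha>"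
    using assms unfolding integers_perp_eq by blast
  have "degree (smult (of_nat p) (f - [:coeff f 0:])) < p"
    using f(1) by (intro le_less_trans[OF degree_smult_le] degree_diff_less) simp_all
  then have "rep_poly x = smult (of_nat p) (f - [:coeff f 0:])" using rep_ev f(3) by metis
  with f that show ?thesis by blast
qed

lemma coeff_0_rep_M: "x \<in> M \<Longrightarrow> coeff (rep_poly x) 0 = 0"
  by (erule M_cases) simp

text \<open>The factor \<open>p\<close> in the definition of \<open>perp\<close> absorbs the one in
  \<open>coeff_denominator\<close>.\<close>

lemma coord_denominator: "x \<in> M \<Longrightarrow> Suc i < p \<Longrightarrow> of_int m * coord i x \<in> \<int>"
proof -
  assume x: "x \<in> M" "Suc i < p"
  from x(1) obtain f where f: "degree f < p" "algebraic_int (ev f \<alpha>)"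
    "rep_poly x = smult (of_nat p) (f - [:coeff f 0:])" by (rule M_cases)
  have eq: "of_int m * coord i x = of_nat p * of_int m * coeff f (Suc i)"
    by (simp add: coord_def f(3))
  show ?thesis unfolding eq by (rule coeff_denominator[OF f(2,1) x(2)])
qed

lemma M_zero: "0 \<in> M"
  unfolding integers_perp_eq by (rule CollectI, rule exI[of _ 0]) simp

lemma M_diff: "x \<in> M \<Longrightarrow> y \<in> M \<Longrightarrow> x - y \<in> M"
proof -
  assume "x \<in> M" "y \<in> M"
  then obtain f g where f: "degree f < p" "algebraic_int (ev f \<alpha>)"
    "x = ev (smult (of_nat p) (f - [:coeff f 0:])) \<alpha>"
    and g: "degree g < p" "algebraic_int (ev g \<alpha>)"
    "y = ev (smult (of_nat p) (g - [:coeff g 0:])) \<alpha>" by (metis M_cases)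
  have "x - y = ev (smult (of_nat p) ((f - g) - [:coeff (f - g) 0:])) \<alpha>"
    by (simp add: f(3) g(3) of_rat_diff algebra_simps)
  moreover have "algebraic_int (ev (f - g) \<alpha>)"
    using algebraic_int_plus[OF f(2), of "- ev g \<alpha>"] g(2) by simp
  moreover have "degree (f - g) < p" using f(1) g(1) by (rule degree_diff_less)
  ultimately show ?thesis unfolding integers_perp_eq by blast
qed

text \<open>This gives the lattice full rank: \<open>\<alpha> ^ Suc i\<close> is integral of trace
  0, so \<open>perp\<close> only multiplies it by \<open>p\<close>.\<close>

lemma power_in_M:
  assumes "Suc i < p"
  shows "of_nat p * \<alpha> ^ Suc i \<in> M"
proof -
  have "algebraic_int (ev (monom 1 (Suc i)) \<alpha>)"
    using algebraic_int_power[OF algebraic_int_root[OF root_\<alpha>], of "Suc i"] by simp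
  moreover have "of_nat p * \<alpha> ^ Suc i =
      ev (smult (of_nat p) (monom 1 (Suc i) - [:coeff (monom 1 (Suc i)) 0:])) \<alpha>"
    by simp
  ultimately show ?thesis
    using assms unfolding integers_perp_eq by (intro CollectI exI[of _ "monom 1 (Suc i)"] conjI) (simp_all add: degree_monom_eq)
qed

lemma coord_power: "Suc i < p \<Longrightarrow> coord j (of_nat p * \<alpha> ^ Suc i) = (if i = j then of_nat p else 0)"
  using rep_ev[of "monom (of_nat p) (Suc i)"] degree_monom_le[of "of_nat p :: rat" "Suc i"]
  by (simp add: coord_def)

lemma M_eq_0:
  assumes "x \<in> M" "\<And>i. i < p - 1 \<Longrightarrow> coord i x = 0"
  shows "x = 0"
proof -
  have "coeff (rep_poly x) n = 0" for n
  proof (cases n)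
    case 0
    then show ?thesis using coeff_0_rep_M assms(1) by simp
  next
    case (Suc i)
    show ?thesis
    proof (cases "n < p")
      case True
      then show ?thesis using assms(2)[of i] Suc by (simp add: coord_def)
    next
      case False
      then show ?thesis using degree_rep[OF M_in_K[OF assms(1)]] by (intro coeff_eq_0) simp
    qed
  qed
  then have "rep_poly x = 0" by (simp add: poly_eq_iff)
  then show ?thesis using ev_rep[OF M_in_K[OF assms(1)]] by simp
qed

text \<open>Up to the factor \<open>p\<close>, the matrix \<open>N\<close> inverts the coordinate
  matrix of the basis. It gives independence over the integers here, independence over the reals for
  positive definiteness, and the passage from the basis back to the powers of \<alpha>.\<close>

lemma Z_basis_exists:
  obtains bs and N :: "nat \<Rightarrow> nat \<Rightarrow> int" where "is_Z_basis bs M" "length bs = p - 1"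
    "\<And>i. i < p - 1 \<Longrightarrow> of_nat p * \<alpha> ^ Suc i = (\<Sum>j<p - 1. of_int (N i j) * bs ! j)"
    "\<And>i j. i < p - 1 \<Longrightarrow> j < p - 1 \<Longrightarrow>
       (\<Sum>k<p - 1. coord k (bs ! i) * of_int (N k j)) = (if i = j then of_nat p else 0)"
proof -
  let ?d = "p - 1"
  \<comment> \<open>The floor is exact on the lattice. The value 0 beyond the range makes
    \<open>c i\<close> additive for every \<open>i\<close>, as \<open>subgroup_generators\<close>
    demands.\<close>
  define c where "c i x = (if i < ?d then \<lfloor>of_int m * coord i x\<rfloor> else 0)" for i x
  have c: "of_int (c i x) = of_int m * coord i x" if "x \<in> M" "i < ?d" for i x
    using coord_denominator[OF that(1), of i] that(2) by (auto simp: c_def elim!: Ints_cases)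
  have "\<exists>b. (\<forall>i<?d. b i \<in> M) \<and> M \<subseteq> int_lin {..<?d} b"
  proof (rule subgroup_generators[where c = c])
    fix i x y assume xy: "x \<in> M" "y \<in> M"
    show "c i (x - y) = c i x - c i y"
    proof (cases "i < ?d")
      case True
      have "(of_int (c i (x - y)) :: rat) = of_int (c i x - c i y)"
        using xy M_diff[OF xy] True by (simp add: c coord_diff M_in_K algebra_simps)
      then show ?thesis by (simp only: of_int_eq_iff)
    qed (simp add: c_def)
  next
    fix x assume x: "x \<in> M" "\<And>i. i < ?d \<Longrightarrow> c i x = 0"
    show "x = 0"
      using x(2) c[OF x(1)] by (intro M_eq_0[OF x(1)]) (metis m_nonzero mult_eq_0_iff of_int_0 of_int_eq_0_iff)
  qed (simp_all add: M_zero M_diff)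
  then obtain b where b: "\<And>i. i < ?d \<Longrightarrow> b i \<in> M" "M \<subseteq> int_lin {..<?d} b" by blast
  then have M: "int_lin {..<?d} b = M"
    using int_lin_subset[of M "{..<?d}" b] M_zero M_diff by auto
  define bs where "bs = map b [0..<?d]"
  have bs: "length bs = ?d" "\<And>i. i < ?d \<Longrightarrow> bs ! i = b i" by (simp_all add: bs_def)
  have "\<exists>N :: nat \<Rightarrow> int. of_nat p * \<alpha> ^ Suc i = (\<Sum>j<?d. of_int (N j) * b j)" if "i < ?d" for i
  proof -
    have "of_nat p * \<alpha> ^ Suc i \<in> int_lin {..<?d} b"
      unfolding M using that by (intro power_in_M) simp
    then show ?thesis by (auto simp: int_lin_def)
  qed
  then obtain N :: "nat \<Rightarrow> nat \<Rightarrow> int"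
    where N: "\<And>i. i < ?d \<Longrightarrow> of_nat p * \<alpha> ^ Suc i = (\<Sum>j<?d. of_int (N i j) * b j)"
    by metis
  have "(\<Sum>k<?d. of_int (N i k) * coord j (b k)) = (if i = j then of_nat p else 0)" if "i < ?d" for i j
    using coord_int_sum[of ?d b j "N i"] coord_power[of i j] N[OF that] that b(1) by (simp add: M_in_K)
  then have inv: "(\<Sum>k<?d. coord k (b i) * of_int (N k j)) = (if i = j then of_nat p else 0)" if "i < ?d" "j < ?d" for i j
    using right_inverse_if_left_inverse[of "of_nat p :: rat" ?d "\<lambda>i j. of_int (N i j)" "\<lambda>i j. coord j (b i)" i j] that
    by simp
  have "is_Z_basis bs M"
    unfolding is_Z_basis_iff bs(1)
  proof (intro conjI allI impI)
    fix k :: "nat \<Rightarrow> int" and i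
    assume k: "(\<Sum>i<?d. of_int (k i) * bs ! i) = 0" and i: "i < ?d"
    then have "(\<Sum>i<?d. of_int (k i) * b i) = 0" by (simp add: bs(2))
    then have coord: "(\<Sum>j<?d. of_int (k j) * coord l (b j)) = 0" for l
      using coord_int_sum[of ?d b l k] b(1) rep_ev[of 0] by (simp add: M_in_K coord_def)
    \<comment> \<open>Multiplying the vanishing coordinates by \<open>N\<close> leaves
      \<open>p * k i\<close>.\<close>
    have "0 = (\<Sum>l<?d. (\<Sum>j<?d. of_int (k j) * coord l (b j)) * of_int (N l i))"
      unfolding coord by simp
    also have "\<dots> = (\<Sum>j<?d. of_int (k j) * (\<Sum>l<?d. coord l (b j) * of_int (N l i)))"
      unfolding sum_distrib_left sum_distrib_right by (subst sum.swap) (simp add: mult.assoc)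
    also have "\<dots> = (\<Sum>j<?d. if j = i then of_int (k i) * of_nat p else 0)"
    proof (rule sum.cong[OF refl])
      fix j assume "j \<in> {..<?d}"
      then show "of_int (k j) * (\<Sum>l<?d. coord l (b j) * of_int (N l i)) =
          (if j = i then of_int (k i) * of_nat p else 0)"
        using inv[of j i] i by auto
    qed
    also have "\<dots> = of_int (k i) * of_nat p" using i by simp
    finally show "k i = 0" using p_gt_2 by auto
  next
    have "int_lin {..<?d} ((!) bs) = int_lin {..<?d} b"
      unfolding int_lin_def by (simp add: bs(2))
    then show "int_lin {..<?d} ((!) bs) = M" using M by simp
  qed
  then show ?thesis
    using that[of bs N] bs N inv by simp
qed

end

section \<open>The Gram matrix and monomiality\<close>

lemma sum_lessThan_pred: "n > 0 \<Longrightarrow> (\<Sum>i<n. f i) = f 0 + (\<Sum>i<n - 1. f (Suc i))" for f :: "nat \<Rightarrow> 'a::comm_monoid_add"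
  by (cases n) (simp_all add: sum.lessThan_Suc_shift del: sum.lessThan_Suc)

section \<open>Rational relations between the powers of \<open>w\<close>\<close>

context pure_radicand
begin

text \<open>Since 2 is coprime to the odd \<open>p\<close>, a \<open>p\<close>-th root of
  \<open>m\<^sup>2\<close> would yield one of \<open>m\<close>.\<close>

lemma pure_radicand_square: "pure_radicand p (m\<^sup>2)"
proof
  fix q :: rat
  show "q ^ p \<noteq> of_int (m\<^sup>2)"
  proof
    assume "q ^ p = of_int (m\<^sup>2)"
    then have "q ^ p = of_int m ^ 2" by simp
    moreover have "coprime 2 p" using odd_p by simp
    ultimately obtain r :: rat where "r ^ p = of_int m"
      using coprime_power_eq_imp_power[of q p "of_int m" 2] by auto
    then show False using not_power by blast
  qed
qed (rule prime_p odd_p)+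

lemma w_independent:
  assumes "(\<Sum>l<p - 1. of_rat (c l) * w ^ Suc l) = 0" "l < p - 1"
  shows "c l = 0"
proof -
  interpret S: pure_radicand p "m\<^sup>2" by (rule pure_radicand_square)
  \<comment> \<open>Shift by one: the relation has no constant term, while
    \<open>power_independent\<close> starts at exponent 0.\<close>
  define b where "b i = (if i = 0 then 0 else c (i - 1))" for i
  have "(\<Sum>i<p. of_rat (b i) * w ^ i) = 0"
    unfolding sum_lessThan_pred[OF p_gt_0] using assms(1) by (simp add: b_def)
  from S.power_independent[OF w_power this, of "Suc l"] show ?thesis
    using assms(2) by (simp add: b_def)
qed

text \<open>Orthogonality of two rows is a rational relation between independent powers of
  \<open>w\<close>, so every product \<open>T i l * T j l\<close> vanishes. There are
  \<open>p - 1\<close> nonzero rows with disjoint supports in \<open>p - 1\<close> columns, which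
  leaves exactly one entry in each row.\<close>

lemma diagonal_form_monomial:
  fixes T :: "nat \<Rightarrow> nat \<Rightarrow> rat"
  assumes T: "\<And>i j. i < p - 1 \<Longrightarrow> j < p - 1 \<Longrightarrow>
      (\<Sum>l<p - 1. of_rat (T i l * T j l) * w ^ Suc l) = (if i = j then e i else 0)"
    and e: "\<And>i. i < p - 1 \<Longrightarrow> e i \<noteq> 0"
    and i: "i < p - 1"
  shows "\<exists>l t. t \<noteq> 0 \<and> e i = of_rat t ^ 2 * w ^ Suc l"
proof -
  let ?d = "p - 1"
  have orth: "T i l * T j l = 0" if "i < ?d" "j < ?d" "i \<noteq> j" "l < ?d" for i j l
    using T[OF that(1,2)] that(3) by (intro w_independent[of "\<lambda>l. T i l * T j l"] that(4)) simp
  have "\<exists>l<?d. T i l \<noteq> 0" if "i < ?d" for i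
  proof (rule ccontr)
    assume "\<not> (\<exists>l<?d. T i l \<noteq> 0)"
    then have "(\<Sum>l<?d. real_of_rat (T i l * T i l) * w ^ Suc l) = 0" by (intro sum.neutral) auto
    with T[OF that that] e[OF that] show False by simp
  qed
  then obtain \<pi> where \<pi>: "\<And>i. i < ?d \<Longrightarrow> \<pi> i < ?d" "\<And>i. i < ?d \<Longrightarrow> T i (\<pi> i) \<noteq> 0" by metis
  have inj: "inj_on \<pi> {..<?d}"
  proof (rule inj_onI)
    fix i j assume "i \<in> {..<?d}" "j \<in> {..<?d}" "\<pi> i = \<pi> j"
    then show "i = j" using orth[of i j "\<pi> i"] \<pi>[of i] \<pi>[of j] by auto
  qed
  have "\<pi> ` {..<?d} \<subseteq> {..<?d}"
    by (rule image_subsetI) (simp only: lessThan_iff \<pi>(1))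
  then have surj: "\<pi> ` {..<?d} = {..<?d}"
    by (rule endo_inj_surj[OF finite_lessThan _ inj])
  \<comment> \<open>By surjectivity of \<open>\<pi>\<close>, the column \<open>l\<close> holds the
    nonzero entry of another row \<open>j\<close>.\<close>
  have zero: "T i l = 0" if "l < ?d" "l \<noteq> \<pi> i" for l
  proof -
    have "l \<in> \<pi> ` {..<?d}" unfolding surj using that(1) by simp
    then obtain j where j: "j < ?d" "l = \<pi> j" by auto
    then have "i \<noteq> j" using that(2) by auto
    then have "T i l * T j l = 0" by (rule orth[OF i j(1) _ that(1)])
    then show ?thesis using \<pi>(2)[OF j(1)] j(2) by simp
  qed
  have "e i = (\<Sum>l<?d. real_of_rat (T i l * T i l) * w ^ Suc l)"
    using T[OF i i] by simp
  also have "\<dots> = (\<Sum>l<?d. if l = \<pi> i then of_rat (T i l) ^ 2 * w ^ Suc l else 0)"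
    by (intro sum.cong refl) (simp add: zero of_rat_mult power2_eq_square)
  also have "\<dots> = of_rat (T i (\<pi> i)) ^ 2 * w ^ Suc (\<pi> i)"
    using \<pi>(1)[OF i] by simp
  finally show ?thesis using \<pi>(2)[OF i] by blast
qed

end

text \<open>Change of basis for a diagonal form. The scalar \<open>c\<close> stands for
  \<open>p\<close>, or for \<open>r\<^sup>2 * p\<close> in the presence of a similitude.\<close>

lemma sum_bilinear_diagonal:
  fixes u v W :: "nat \<Rightarrow> 'a::comm_ring_1"
  shows "(\<Sum>i<n. \<Sum>j<n'. u i * v j * (c * (\<Sum>l<d. x i l * y j l * W l))) =
    c * (\<Sum>l<d. (\<Sum>i<n. u i * x i l) * (\<Sum>j<n'. v j * y j l) * W l)"
proof -
  have "(\<Sum>i<n. \<Sum>j<n'. u i * v j * (c * (\<Sum>l<d. x i l * y j l * W l))) =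
    (\<Sum>i<n. \<Sum>j<n'. \<Sum>l<d. c * ((u i * x i l) * (v j * y j l) * W l))"
    unfolding sum_distrib_left by (intro sum.cong refl) (simp add: ac_simps)
  also have "\<dots> = (\<Sum>l<d. \<Sum>i<n. \<Sum>j<n'. c * ((u i * x i l) * (v j * y j l) * W l))"
    by (subst sum.swap, subst (2) sum.swap) (rule refl)
  also have "\<dots> = c * (\<Sum>l<d. (\<Sum>i<n. u i * x i l) * (\<Sum>j<n'. v j * y j l) * W l)"
    unfolding sum_product unfolding sum_distrib_right sum_distrib_left ..
  finally show ?thesis .
qed

section \<open>The Gram matrix in coordinates\<close>

context pure_element
begin

text \<open>On the lattice this is the Minkowski form: constant coefficients vanish there, so the
  sum starts at exponent 1.\<close>

definition inner :: "'a \<Rightarrow> 'a \<Rightarrow> real" where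
  "inner x y = of_nat p * (\<Sum>l<p - 1. of_rat (coord l x * coord l y) * w ^ Suc l)"

lemma Re_minkowski_inner:
  assumes "x \<in> M" "y \<in> M"
  shows "Re (minkowski K x \<bullet>c minkowski K y) = inner x y"
proof -
  have "minkowski K x \<bullet>c minkowski K y =
      of_nat p * of_real (\<Sum>i<p. of_rat (coeff (rep_poly x) i * coeff (rep_poly y) i) * w ^ i)"
    using gram_form[OF degree_rep degree_rep, of x y] assms by (simp add: M_in_K ev_rep)
  then have "Re (minkowski K x \<bullet>c minkowski K y) =
      of_nat p * (\<Sum>i<p. of_rat (coeff (rep_poly x) i * coeff (rep_poly y) i) * w ^ i)"
    by simp
  then show ?thesis
    unfolding sum_lessThan_pred[OF p_gt_0] inner_def coord_def
    using coeff_0_rep_M[OF assms(1)] by simp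
qed

lemma Z_basis_in_M:
  assumes "is_Z_basis bs M" "i < length bs"
  shows "bs ! i \<in> M"
  using int_lin_gen[of "{..<length bs}" i "(!) bs"] assms unfolding is_Z_basis_iff by auto

lemma gram_matrix_index:
  assumes "is_Z_basis bs M" "i < length bs" "j < length bs"
  shows "gram_matrix K bs $$ (i, j) = inner (bs ! i) (bs ! j)"
  using assms Z_basis_in_M[OF assms(1)] by (simp add: gram_matrix_def Re_minkowski_inner)

lemma gram_matrix_carrier: "gram_matrix K bs \<in> carrier_mat (length bs) (length bs)"
  by (simp add: gram_matrix_def)

lemma inner_commute: "inner x y = inner y x"
  by (simp add: inner_def mult.commute)

text \<open>The coefficients are real because positive definiteness is tested on real
  vectors.\<close>

lemma inner_real_combination:
  fixes u v :: "nat \<Rightarrow> real"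
  shows "(\<Sum>i<n. \<Sum>j<n'. u i * v j * inner (x i) (y j)) =
    of_nat p * (\<Sum>l<p - 1. (\<Sum>i<n. u i * of_rat (coord l (x i))) * (\<Sum>j<n'. v j * of_rat (coord l (y j))) * w ^ Suc l)"
proof -
  have "inner (x i) (y j) =
      of_nat p * (\<Sum>l<p - 1. of_rat (coord l (x i)) * of_rat (coord l (y j)) * w ^ Suc l)" for i j
    by (simp add: inner_def of_rat_mult)
  then show ?thesis by (simp only: sum_bilinear_diagonal)
qed

text \<open>\<open>shape_rel\<close> relates only positive definite matrices, so without this the
  Gram matrix would not lie in its own class. The form is a sum of squares with positive weights,
  and \<open>N\<close> shows that they do not all vanish.\<close>

lemma gram_matrix_pos_def:
  fixes N :: "nat \<Rightarrow> nat \<Rightarrow> int"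
  assumes bs: "is_Z_basis bs M" "length bs = p - 1"
    and N: "\<And>i j. i < p - 1 \<Longrightarrow> j < p - 1 \<Longrightarrow>
       (\<Sum>k<p - 1. coord k (bs ! i) * of_int (N k j)) = (if i = j then of_nat p else 0)"
  shows "gram_matrix K bs \<in> pos_def_mats (p - 1)"
proof -
  let ?d = "p - 1" and ?G = "gram_matrix K bs"
  have G: "?G \<in> carrier_mat ?d ?d" using gram_matrix_carrier[of bs] bs(2) by simp
  have idx: "?G $$ (i, j) = inner (bs ! i) (bs ! j)" if "i < ?d" "j < ?d" for i j
    using gram_matrix_index[OF bs(1)] that bs(2) by simp
  have "?G\<^sup>T = ?G"
    using G by (intro eq_matI) (auto simp: idx inner_commute)
  moreover have "v \<bullet> (?G *\<^sub>v v) > 0" if v: "v \<in> carrier_vec ?d" "v \<noteq> 0\<^sub>v ?d" for v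
  proof -
    define s where "s l = (\<Sum>i<?d. v $ i * real_of_rat (coord l (bs ! i)))" for l
    have "v \<bullet> (?G *\<^sub>v v) = (\<Sum>i<?d. \<Sum>j<?d. v $ i * v $ j * inner (bs ! i) (bs ! j))"
      using v G unfolding scalar_prod_def
      by (auto simp: scalar_prod_def idx lessThan_atLeast0 sum_distrib_left ac_simps intro!: sum.cong)
    also have "\<dots> = of_nat p * (\<Sum>l<?d. s l * s l * w ^ Suc l)"
      unfolding inner_real_combination s_def ..
    also have "\<dots> > 0"
    proof -
      obtain j where j: "j < ?d" "v $ j \<noteq> 0" using v by (metis carrier_vecD eq_vecI index_zero_vec)
      have "\<exists>l<?d. s l \<noteq> 0"
      proof (rule ccontr)
        assume "\<not> (\<exists>l<?d. s l \<noteq> 0)"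
        \<comment> \<open>Multiplying the coordinates \<open>s\<close> of the real combination by
          \<open>N\<close> recovers \<open>p * v $ j\<close>.\<close>
        then have "0 = (\<Sum>l<?d. s l * of_int (N l j))" by simp
        also have "\<dots> = (\<Sum>i<?d. v $ i * of_rat (\<Sum>l<?d. coord l (bs ! i) * of_int (N l j)))"
          unfolding s_def sum_distrib_right of_rat_sum sum_distrib_left
          by (subst sum.swap) (simp add: of_rat_mult mult.assoc)
        also have "\<dots> = (\<Sum>i<?d. if i = j then v $ j * of_nat p else 0)"
        proof (rule sum.cong[OF refl])
          fix i assume "i \<in> {..<?d}"
          then show "v $ i * of_rat (\<Sum>l<?d. coord l (bs ! i) * of_int (N l j)) = (if i = j then v $ j * of_nat p else 0)"
            using N[of i j] j(1) by auto
        qed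
        also have "\<dots> = v $ j * of_nat p" using j(1) by simp
        finally show False using j(2) p_gt_2 by simp
      qed
      then obtain l where l: "l < ?d" "s l \<noteq> 0" by blast
      have "0 < (\<Sum>l<?d. s l * s l * w ^ Suc l)"
      proof (rule sum_pos2[of _ l])
        show "0 < s l * s l * w ^ Suc l"
          using l(2) w_pos by (metis mult_pos_pos not_real_square_gt_zero zero_less_power)
        show "0 \<le> s i * s i * w ^ Suc i" for i
          by (rule mult_nonneg_nonneg) (use w_pos in auto)
      qed (use l in auto)
      then show ?thesis by simp
    qed
    finally show ?thesis .
  qed
  ultimately show ?thesis using G by (simp add: pos_def_mats_def)
qed

end

lemma gram_transformation_index:
  fixes g :: "int mat" and G H :: "real mat"
  assumes "g \<in> carrier_mat d d" "G \<in> carrier_mat d d" "H = c \<cdot>\<^sub>m (map_mat of_int g * G * (map_mat of_int g)\<^sup>T)"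
    and "i < d" "j < d"
  shows "H $$ (i, j) = c * (\<Sum>u<d. \<Sum>v<d. of_int (g $$ (i, u)) * of_int (g $$ (j, v)) * G $$ (u, v))"
proof -
  have "H $$ (i, j) = c * (\<Sum>u<d. of_int (g $$ (i, u)) * (\<Sum>v<d. G $$ (u, v) * of_int (g $$ (j, v))))"
    using assms by (simp add: scalar_prod_def lessThan_atLeast0)
  then show ?thesis by (simp add: sum_distrib_left ac_simps)
qed

section \<open>Recovering the field from the shape\<close>

lemma shape_rel_refl: "G \<in> pos_def_mats d \<Longrightarrow> (G, G) \<in> shape_rel d"
proof -
  assume G: "G \<in> pos_def_mats d"
  then have c: "G \<in> carrier_mat d d" by (simp add: pos_def_mats_def)
  have "invertible_mat (1\<^sub>m d :: int mat)"
    unfolding invertible_mat_def inverts_mat_def by (auto intro!: exI[of _ "1\<^sub>m d"])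
  then have "1\<^sub>m d \<in> GL_int d" by (simp add: GL_int_def)
  moreover have "G = 1\<^sup>2 \<cdot>\<^sub>m (map_mat of_int (1\<^sub>m d) * G * (map_mat of_int (1\<^sub>m d))\<^sup>T)"
    using c by (simp add: of_int_hom.mat_hom_one) (intro eq_matI, auto)
  ultimately have "\<exists>g\<in>GL_int d. \<exists>r::real. r \<noteq> 0 \<and>
      G = r\<^sup>2 \<cdot>\<^sub>m (map_mat of_int g * G * (map_mat of_int g)\<^sup>T)"
    using zero_neq_one by metis
  then show ?thesis using G unfolding shape_rel_def by simp
qed

text \<open>The similitude is assembled from three matrices: \<open>N\<close> from the powers of
  \<alpha> to the first basis, \<open>g\<close> between the bases, and the coordinates of the second
  basis in powers of \<beta>. Their product is rational, and the real scale enters only through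
  \<open>c = p\<^sup>2 / r\<^sup>2\<close>.\<close>

lemma shape_eq_obtain_proportional_powers:
  fixes \<alpha> :: "'a::field_char_0" and \<beta> :: "'b::field_char_0"
  assumes "pure_element p m \<alpha>" "pure_element p n \<beta>" "shape (pure_gen \<alpha>) = shape (pure_gen \<beta>)"
  obtains c :: real where "c \<noteq> 0"
    "\<And>i. i < p - 1 \<Longrightarrow> \<exists>l t. t \<noteq> 0 \<and>
       c * pure_radicand.w p m ^ Suc i = of_rat t ^ 2 * pure_radicand.w p n ^ Suc l"
proof -
  interpret A: pure_element p m \<alpha> by fact
  interpret B: pure_element p n \<beta> by fact
  let ?d = "p - 1"
  obtain bs and N :: "nat \<Rightarrow> nat \<Rightarrow> int" where bs: "is_Z_basis bs A.M" "length bs = ?d"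
    and N: "\<And>i. i < ?d \<Longrightarrow> of_nat p * \<alpha> ^ Suc i = (\<Sum>j<?d. of_int (N i j) * bs ! j)"
    and inv: "\<And>i j. i < ?d \<Longrightarrow> j < ?d \<Longrightarrow>
       (\<Sum>k<?d. A.coord k (bs ! i) * of_int (N k j)) = (if i = j then of_nat p else 0)"
    by (rule A.Z_basis_exists) blast
  define G where "G = gram_matrix A.K bs"
  have "G \<in> pos_def_mats ?d"
    unfolding G_def by (rule A.gram_matrix_pos_def[OF bs inv])
  then have "(G, G) \<in> shape_rel ?d" by (rule shape_rel_refl)
  then have "G \<in> shape A.K"
    unfolding shape_def A.field_degree_K G_def using bs(1) by blast
  then have "G \<in> shape B.K" using assms(3) by simp
  then obtain bs' where bs': "is_Z_basis bs' B.M" "(gram_matrix B.K bs', G) \<in> shape_rel ?d"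
    unfolding shape_def B.field_degree_K by blast
  define G' where "G' = gram_matrix B.K bs'"
  obtain g r where g: "g \<in> carrier_mat ?d ?d" and r: "r \<noteq> 0"
    and G': "G' \<in> carrier_mat ?d ?d"
    and GG': "G = r\<^sup>2 \<cdot>\<^sub>m (map_mat of_int g * G' * (map_mat of_int g)\<^sup>T)"
    using bs'(2) unfolding shape_rel_def GL_int_def pos_def_mats_def G'_def by blast
  have len': "length bs' = ?d"
    using G' B.gram_matrix_carrier[of bs'] unfolding G'_def by (metis carrier_matD(1))
  \<comment> \<open>\<open>s k\<close> is the coordinate vector of the \<open>k\<close>-th element
    of the second basis after transformation by \<open>g\<close>; \<open>T i\<close> is the
    resulting image of \<open>p * \<alpha> ^ Suc i\<close>.\<close>
  define s where "s k q = (\<Sum>u<?d. of_int (g $$ (k, u)) * B.coord q (bs' ! u))" for k q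
  define T where "T i q = (\<Sum>k<?d. of_int (N i k) * s k q)" for i q
  have G_eq: "A.inner (bs ! k) (bs ! l) =
      r\<^sup>2 * of_nat p * (\<Sum>q<?d. of_rat (s k q) * of_rat (s l q) * B.w ^ Suc q)"
    if kl: "k < ?d" "l < ?d" for k l
  proof -
    have "A.inner (bs ! k) (bs ! l) = G $$ (k, l)"
      unfolding G_def using A.gram_matrix_index[OF bs(1)] kl bs(2) by simp
    also have "\<dots> = r\<^sup>2 * (\<Sum>u<?d. \<Sum>v<?d. of_int (g $$ (k, u)) * of_int (g $$ (l, v)) * G' $$ (u, v))"
      by (rule gram_transformation_index[OF g G' GG' kl])
    also have "(\<Sum>u<?d. \<Sum>v<?d. of_int (g $$ (k, u)) * of_int (g $$ (l, v)) * G' $$ (u, v)) =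
        (\<Sum>u<?d. \<Sum>v<?d. of_int (g $$ (k, u)) * of_int (g $$ (l, v)) * B.inner (bs' ! u) (bs' ! v))"
      unfolding G'_def using B.gram_matrix_index[OF bs'(1)] len' by (intro sum.cong refl) simp
    also have "\<dots> = of_nat p * (\<Sum>q<?d. of_rat (s k q) * of_rat (s l q) * B.w ^ Suc q)"
      unfolding B.inner_real_combination s_def by (simp only: of_rat_sum of_rat_mult of_rat_of_int_eq)
    finally show ?thesis by simp
  qed
  have "(\<Sum>q<?d. of_rat (T i q * T j q) * B.w ^ Suc q) =
      (if i = j then of_nat p ^ 2 / r\<^sup>2 * A.w ^ Suc i else 0)" if ij: "i < ?d" "j < ?d" for i j
  proof -
    have coord: "(\<Sum>k<?d. of_int (N i k) * real_of_rat (A.coord l (bs ! k))) = (if i = l then of_nat p else 0)"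
      if "i < ?d" for i l
    proof -
      have "bs ! k \<in> A.K" if "k < ?d" for k
        using A.Z_basis_in_M[OF bs(1)] that bs(2) A.M_in_K by simp
      then have "(\<Sum>k<?d. of_int (N i k) * A.coord l (bs ! k)) = (if i = l then of_nat p else 0)"
        using A.coord_int_sum[of ?d "\<lambda>k. bs ! k" l "N i"] N[OF \<open>i < ?d\<close>] A.coord_power[of i l] \<open>i < ?d\<close>
        by simp
      then have "real_of_rat (\<Sum>k<?d. of_int (N i k) * A.coord l (bs ! k)) = (if i = l then of_nat p else 0)"
        by simp
      then show ?thesis by (simp add: of_rat_sum of_rat_mult)
    qed
    \<comment> \<open>The inner product of \<open>p * \<alpha> ^ Suc i\<close> and
      \<open>p * \<alpha> ^ Suc j\<close> is computed twice: here in the first field, then through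
      the similitude in the second.\<close>
    have "(\<Sum>k<?d. \<Sum>l<?d. of_int (N i k) * of_int (N j l) * A.inner (bs ! k) (bs ! l)) =
        of_nat p * (\<Sum>l<?d. (if i = l then of_nat p else 0) * (if j = l then of_nat p else 0) * A.w ^ Suc l)"
      unfolding A.inner_real_combination coord[OF ij(1)] coord[OF ij(2)] ..
    also have "(\<Sum>l<?d. (if i = l then of_nat p else 0) * (if j = l then of_nat p else 0) * A.w ^ Suc l) =
        (\<Sum>l<?d. if l = i then (if i = j then of_nat p ^ 2 * A.w ^ Suc i else 0) else 0)"
      by (intro sum.cong refl) (auto simp: power2_eq_square)
    also have "\<dots> = (if i = j then of_nat p ^ 2 * A.w ^ Suc i else 0)"
      using ij(1) by simp
    finally have lhs: "(\<Sum>k<?d. \<Sum>l<?d. of_int (N i k) * of_int (N j l) * A.inner (bs ! k) (bs ! l)) =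
        of_nat p * (if i = j then of_nat p ^ 2 * A.w ^ Suc i else 0)" .
    have "(\<Sum>k<?d. \<Sum>l<?d. of_int (N i k) * of_int (N j l) * A.inner (bs ! k) (bs ! l)) =
        (\<Sum>k<?d. \<Sum>l<?d. of_int (N i k) * of_int (N j l) *
          (r\<^sup>2 * of_nat p * (\<Sum>q<?d. of_rat (s k q) * of_rat (s l q) * B.w ^ Suc q)))"
      by (intro sum.cong refl) (simp only: G_eq lessThan_iff)
    also have "\<dots> = r\<^sup>2 * of_nat p * (\<Sum>q<?d. (\<Sum>k<?d. of_int (N i k) * of_rat (s k q)) *
        (\<Sum>l<?d. of_int (N j l) * of_rat (s l q)) * B.w ^ Suc q)"
      by (rule sum_bilinear_diagonal)
    also have "\<dots> = r\<^sup>2 * of_nat p * (\<Sum>q<?d. of_rat (T i q * T j q) * B.w ^ Suc q)"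
      unfolding T_def by (simp only: of_rat_sum of_rat_mult of_rat_of_int_eq)
    finally have "r\<^sup>2 * of_nat p * (\<Sum>q<?d. of_rat (T i q * T j q) * B.w ^ Suc q) =
        of_nat p * (if i = j then of_nat p ^ 2 * A.w ^ Suc i else 0)"
      unfolding lhs by (rule sym)
    then have "r\<^sup>2 * (\<Sum>q<?d. of_rat (T i q * T j q) * B.w ^ Suc q) =
        (if i = j then of_nat p ^ 2 * A.w ^ Suc i else 0)"
      using A.p_gt_0 by simp
    then show ?thesis using r by (auto simp: field_simps split: if_splits)
  qed
  moreover have "of_nat p ^ 2 / r\<^sup>2 * A.w ^ Suc i \<noteq> 0" for i
    using r A.w_pos A.p_gt_0 by simp
  ultimately have "\<exists>l t. t \<noteq> 0 \<and> of_nat p ^ 2 / r\<^sup>2 * A.w ^ Suc i = of_rat t ^ 2 * B.w ^ Suc l"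
    if "i < ?d" for i
    using that by (rule B.diagonal_form_monomial)
  then show ?thesis
    using r A.p_gt_0 by (intro that[of "of_nat p ^ 2 / r\<^sup>2"]) simp_all
qed

text \<open>The quotient of the two proportionalities is free of \<open>c\<close>. Its
  \<open>p\<close>-th power is an equation between squares of rationals, whose root expresses
  \<open>m\<close> as a \<open>p\<close>-th power times a power of \<open>n\<close>, possibly with
  negative exponent.\<close>

lemma shape_eq_obtain_root:
  fixes \<alpha> :: "'a::field_char_0" and \<beta> :: "'b::field_char_0"
  assumes "pure_element p m \<alpha>" "pure_element p n \<beta>" "shape (pure_gen \<alpha>) = shape (pure_gen \<beta>)"
  obtains \<gamma> where "\<gamma> \<in> pure_gen \<beta>" "\<gamma> ^ p = of_int m"
proof -
  interpret A: pure_element p m \<alpha> by fact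
  interpret B: pure_element p n \<beta> by fact
  obtain c :: real where c: "c \<noteq> 0"
    and prp: "\<And>i. i < p - 1 \<Longrightarrow> \<exists>l t. t \<noteq> 0 \<and> c * A.w ^ Suc i = of_rat t ^ 2 * B.w ^ Suc l"
    by (rule shape_eq_obtain_proportional_powers[OF assms]) blast
  have "0 < p - 1" "1 < p - 1" using A.p_gt_2 by simp_all
  note prp = prp[OF this(1)] prp[OF this(2)]
  obtain a t where t: "t \<noteq> 0" "c * A.w ^ Suc 0 = of_rat t ^ 2 * B.w ^ Suc a"
    using prp(1) by blast
  obtain b u where u: "u \<noteq> 0" "c * A.w ^ Suc 1 = of_rat u ^ 2 * B.w ^ Suc b"
    using prp(2) by blast
  have "A.w * (of_rat t ^ 2 * B.w ^ Suc a) = of_rat u ^ 2 * B.w ^ Suc b"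
    unfolding t(2)[symmetric] u(2)[symmetric] by simp
  then have "A.w ^ p * (of_rat t ^ 2 * B.w ^ Suc a) ^ p = (of_rat u ^ 2 * B.w ^ Suc b) ^ p"
    by (metis power_mult_distrib)
  then have "A.w ^ p * ((of_rat t ^ p) ^ 2 * (B.w ^ p) ^ Suc a) = (of_rat u ^ p) ^ 2 * (B.w ^ p) ^ Suc b"
    by (simp only: power_mult_distrib power_mult[symmetric] mult.commute)
  then have "real_of_rat ((of_int m * t ^ p * of_int n ^ Suc a) ^ 2) = real_of_rat ((u ^ p * of_int n ^ Suc b) ^ 2)"
    unfolding A.w_power B.w_power
    by (simp only: of_int_power of_rat_power of_rat_mult of_rat_of_int_eq power_mult_distrib
        power_mult[symmetric] mult.commute mult.left_commute mult.assoc)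
  then have "(of_int m * t ^ p * of_int n ^ Suc a) ^ 2 = (u ^ p * of_int n ^ Suc b) ^ 2"
    by (simp only: of_rat_eq_iff)
  \<comment> \<open>As \<open>p\<close> is odd, the sign of the square root is absorbed into
    \<open>u\<close>.\<close>
  then have "of_int m * t ^ p * of_int n ^ Suc a = u ^ p * of_int n ^ Suc b \<or>
      of_int m * t ^ p * of_int n ^ Suc a = (- u) ^ p * of_int n ^ Suc b"
    using B.odd_p by (simp add: power2_eq_iff)
  then obtain v where v: "of_int m * t ^ p * of_int n ^ Suc a = v ^ p * of_int n ^ Suc b" by blast
  \<comment> \<open>Since \<open>\<beta> ^ p = n\<close>, the equation for \<open>v\<close> says
    that the \<open>p\<close>-th power of this element is \<open>m\<close>.\<close>
  define \<gamma> where "\<gamma> = of_rat (v / t) * \<beta> ^ Suc b * inverse (\<beta> ^ Suc a)"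
  have "\<gamma> \<in> B.K"
    unfolding \<gamma>_def
    by (intro pure_gen_mult pure_gen_of_rat pure_gen_power pure_gen_self B.pure_gen_inverse[OF B.root_\<alpha>])
  moreover have "\<gamma> ^ p = of_int m"
  proof -
    have "\<gamma> ^ p = of_rat (v / t) ^ p * (\<beta> ^ p) ^ Suc b * inverse ((\<beta> ^ p) ^ Suc a)"
      unfolding \<gamma>_def power_mult_distrib power_inverse power_mult[symmetric] by (simp only: mult.commute)
    also have "\<dots> = of_rat ((v / t) ^ p * of_int n ^ Suc b * inverse (of_int n ^ Suc a))"
      unfolding B.root_\<alpha> by (simp only: of_rat_mult of_rat_power of_rat_inverse of_rat_of_int_eq)
    also have "(v / t) ^ p * of_int n ^ Suc b * inverse (of_int n ^ Suc a) = of_int m"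
      using v t(1) B.m_nonzero by (simp add: power_divide divide_simps)
    finally show ?thesis by simp
  qed
  ultimately show ?thesis by (rule that)
qed

text \<open>Equality by degree: an element of \<open>K\<close> outside the subfield generated by
  \<gamma> would give \<open>p + 1\<close> independent elements in a space of dimension
  \<open>p\<close>.\<close>

lemma (in pure_element) pure_gen_eq_of_root:
  assumes "\<gamma> \<in> K" "pure_element p n \<gamma>"
  shows "pure_gen \<gamma> = K"
proof -
  interpret C: pure_element p n \<gamma> by fact
  let ?B = "(\<lambda>i. \<alpha> ^ i) ` {..<p}" and ?C = "(\<lambda>i. \<gamma> ^ i) ` {..<p}"
  have sub: "C.K \<subseteq> K"
    by (intro pure_gen_subset assms pure_gen_of_rat pure_gen_add pure_gen_mult)
  have "K \<subseteq> C.K"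
  proof
    fix x assume x: "x \<in> K"
    show "x \<in> C.K"
    proof (rule ccontr)
      assume "x \<notin> C.K"
      then have x': "x \<notin> rat_vs.span ?C" unfolding C.span_powers .
      then have "rat_vs.independent (insert x ?C)"
        using C.independent_powers by (simp add: rat_vs.independent_insert)
      moreover have "insert x ?C \<subseteq> rat_vs.span ?B"
        unfolding span_powers using x sub by (auto intro: pure_gen_power pure_gen_self)
      ultimately have "card (insert x ?C) \<le> card ?B"
        using rat_vs.independent_span_bound[of ?B "insert x ?C"] by simp
      moreover have "x \<notin> ?C" using x' by (rule contrapos_nn) (rule rat_vs.span_base)
      ultimately show False using C.card_powers card_powers by simp
    qed
  qed
  with sub show ?thesis by blast
qed

text \<open>A rational \<open>p\<close>-th root of \<open>m\<close> would be an integer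
  \<open>k\<close> with \<open>k ^ p = m\<close>. Then \<open>k\<close> is a unit because
  \<open>m\<close> is \<open>p\<close>-th power free, and \<open>m\<close> would be 1 or -1.\<close>

lemma pure_field_obtain:
  fixes K :: "'a::field_char_0 set"
  assumes "prime p" "odd p" "pure_field p K"
  obtains m \<alpha> where "pure_element p m \<alpha>" "K = pure_gen \<alpha>"
proof -
  obtain m \<alpha> where m: "power_free p m" "m \<noteq> 1" "m \<noteq> -1" "\<alpha> ^ p = of_int m"
    and K: "K = generate_field (ring_of_type_algebra :: 'a ring) {\<alpha>}"
    using assms(3) unfolding pure_field_def by blast
  have "q ^ p \<noteq> of_int m" for q :: rat
  proof
    assume q: "q ^ p = of_int m"
    have "algebraic_int q"
      by (rule algebraic_int_root[of "of_int m" "monom 1 p"])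
         (use q prime_gt_0_nat[OF assms(1)] in \<open>auto simp: poly_monom degree_monom_eq int_imp_algebraic_int\<close>)
    then have "q \<in> \<int>" by (rule rational_algebraic_int_is_int) (cases q, simp add: Fract_of_int_quotient)
    then obtain k where "q = of_int k" by (elim Ints_cases)
    with q have k: "k ^ p = m" by (metis of_int_eq_iff of_int_power)
    then have "is_unit k" using m(1) by (auto simp: power_free_def)
    then have "k = 1 \<or> k = -1" by auto
    with k m(2,3) assms(2) show False by auto
  qed
  then interpret pure_element p m \<alpha>
    by unfold_locales (use assms m(4) in auto)
  show ?thesis
    using that[OF pure_element_axioms] generate_field_eq[OF root_\<alpha>] K by simp
qed

theorem theoremB:
  fixes p :: nat and K :: "'a::field_char_0 set" and L :: "'b::field_char_0 set"
  assumes "prime p" and "odd p"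
    and "pure_field p K" and "pure_field p L"
  shows "field_of K \<simeq> field_of L \<longleftrightarrow> shape K = shape L"
proof -
  obtain m \<alpha> where A: "pure_element p m \<alpha>" and K: "K = pure_gen \<alpha>"
    using pure_field_obtain[OF assms(1-3)] .
  obtain n \<beta> where B: "pure_element p n \<beta>" and L: "L = pure_gen \<beta>"
    using pure_field_obtain[OF assms(1,2,4)] .
  interpret A: pure_element p m \<alpha> by fact
  interpret B: pure_element p n \<beta> by fact
  show ?thesis
  proof
    assume "field_of K \<simeq> field_of L"
    then obtain h where h: "h \<in> Ring.ring_hom (field_of K) (field_of L)" "bij_betw h K L"
      unfolding is_ring_iso_def ring_iso_def by auto
    have ev: "h (ev f \<alpha>) = ev f (h \<alpha>)" for f
      using ring_hom_ev[of h \<alpha> L] h(1) unfolding K by blast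
    \<comment> \<open>The image of \<alpha> is a root of the same \<open>m\<close> and, by
      surjectivity, generates \<open>L\<close>; so \<open>L\<close> can be described with the
      radicand of \<open>K\<close>.\<close>
    have "h \<alpha> ^ p = of_int m"
      using ev[of "monom 1 p"] ev[of "[:of_int m:]"] by (simp add: A.root_\<alpha>)
    moreover have "L = pure_gen (h \<alpha>)"
      using h(2) ev unfolding bij_betw_def K pure_gen_def by (auto simp: image_image)
    ultimately show "shape K = shape L"
      unfolding K using A.shape_transfer[OF A.root_\<alpha>] by simp
  next
    assume "shape K = shape L"
    then obtain \<gamma> where \<gamma>: "\<gamma> \<in> pure_gen \<beta>" "\<gamma> ^ p = of_int m"
      unfolding K L by (rule shape_eq_obtain_root[OF A B])
    have "pure_element p m \<gamma>" by unfold_locales (rule \<gamma>(2))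
    then have "L = pure_gen \<gamma>"
      unfolding L using B.pure_gen_eq_of_root[OF \<gamma>(1)] by simp
    then show "field_of K \<simeq> field_of L"
      unfolding K using A.transfer_iso[OF A.root_\<alpha> \<gamma>(2)] by simp
  qed
qed

end
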